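(* Consider Morse polynomials of degree 4 whose degree-4 homogeneous part is positive on $\mathbb R^2\setminus\{0\}$ and non-degenerate. For such a polynomial let $M$ be the number of its critical points in $\mathbb R^2$ and $m_+$ the number of its local maxima. Then the set of pairs $(M,m_+)$ realized by such polynomials is exactly $$\{(1,0),(3,0),(5,0),(7,0),(9,0),(3,1),(5,1),(7,1),(9,1)\};$$ in particular such a polynomial has at most one local maximum.
   Context: A homogeneous polynomial of degree 4 in $(x,y)$ with real coefficients is called non-degenerate if it is a product of four pairwise non-proportional linear forms over $\mathbb C$. A Morse polynomial of degree 4 is a real polynomial $\mathbb R^2\to\mathbb R$ of degree 4 with non-degenerate degree-4 homogeneous part, all of whose critical points in $\mathbb C^2$ are non-degenerate (there are then exactly 9 of them in $\mathbb C^2$). *)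

theory Defs
  imports Complex_Main
begin

text \<open>A real bivariate polynomial of degree at most 4 is represented by its coefficient
  function c, where c i j is the coefficient of x^i y^j; coefficients with i + j > 4 must vanish.\<close>

definition supp4 :: "(nat \<Rightarrow> nat \<Rightarrow> real) \<Rightarrow> bool" where
  "supp4 c \<longleftrightarrow> (\<forall>i j. 4 < i + j \<longrightarrow> c i j = 0)"

definition peval :: "(nat \<Rightarrow> nat \<Rightarrow> real) \<Rightarrow> 'a::real_algebra_1 \<Rightarrow> 'a \<Rightarrow> 'a" where
  "peval c x y = (\<Sum>i\<le>4. \<Sum>j\<le>4 - i. of_real (c i j) * x ^ i * y ^ j)"

definition top4 :: "(nat \<Rightarrow> nat \<Rightarrow> real) \<Rightarrow> 'a::real_algebra_1 \<Rightarrow> 'a \<Rightarrow> 'a" where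
  "top4 c x y = (\<Sum>i\<le>4. of_real (c i (4 - i)) * x ^ i * y ^ (4 - i))"

definition dx :: "(nat \<Rightarrow> nat \<Rightarrow> real) \<Rightarrow> nat \<Rightarrow> nat \<Rightarrow> real" where
  "dx c i j = real (Suc i) * c (Suc i) j"

definition dy :: "(nat \<Rightarrow> nat \<Rightarrow> real) \<Rightarrow> nat \<Rightarrow> nat \<Rightarrow> real" where
  "dy c i j = real (Suc j) * c i (Suc j)"

definition nondegenerate4 :: "(nat \<Rightarrow> nat \<Rightarrow> real) \<Rightarrow> bool" where
  "nondegenerate4 c \<longleftrightarrow> (\<exists>a b :: nat \<Rightarrow> complex.
     (\<forall>k<4. \<forall>l<4. k \<noteq> l \<longrightarrow> a k * b l - a l * b k \<noteq> 0) \<and>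
     (\<forall>z w :: complex. top4 c z w = (\<Prod>k<4. a k * z + b k * w)))"

definition complex_crit :: "(nat \<Rightarrow> nat \<Rightarrow> real) \<Rightarrow> complex \<Rightarrow> complex \<Rightarrow> bool" where
  "complex_crit c z w \<longleftrightarrow> peval (dx c) z w = 0 \<and> peval (dy c) z w = 0"

definition hess_det :: "(nat \<Rightarrow> nat \<Rightarrow> real) \<Rightarrow> 'a::real_algebra_1 \<Rightarrow> 'a \<Rightarrow> 'a" where
  "hess_det c x y = peval (dx (dx c)) x y * peval (dy (dy c)) x y
                    - peval (dx (dy c)) x y * peval (dx (dy c)) x y"

definition morse4 :: "(nat \<Rightarrow> nat \<Rightarrow> real) \<Rightarrow> bool" where
  "morse4 c \<longleftrightarrow> supp4 c \<and> nondegenerate4 c \<and>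
     (\<forall>z w :: complex. complex_crit c z w \<longrightarrow> hess_det c z w \<noteq> 0)"

definition real_crit_points :: "(nat \<Rightarrow> nat \<Rightarrow> real) \<Rightarrow> (real \<times> real) set" where
  "real_crit_points c = {(x, y). peval (dx c) x y = (0::real) \<and> peval (dy c) x y = 0}"

definition local_max_points :: "(nat \<Rightarrow> nat \<Rightarrow> real) \<Rightarrow> (real \<times> real) set" where
  "local_max_points c = {(x, y). \<exists>e>0. \<forall>u v. (u - x)^2 + (v - y)^2 < e^2 \<longrightarrow>
       peval c u v \<le> (peval c x y :: real)}"

end

theory Submission
  imports Defs "HOL-Analysis.Analysis" "HOL-Computational_Algebra.Fundamental_Theorem_Algebra"
begin

text \<open>
  Shear the coordinates so that distinct complex critical points have distinct first coordinates. The
  resultant of the two partial derivatives with respect to y is then a real polynomial of degree exactly 9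
  (nondegeneracy of the quartic part excludes common zeros at infinity) whose real roots are the first
  coordinates of the real critical points, and a nonvanishing Hessian makes each of these roots simple.
  Hence the number of real critical points is odd and at most 9.

  The restriction of f to the line through two local maxima would be a quartic with positive leading
  coefficient and two local maxima, which is impossible. As f also attains a global minimum, a local maximum
  is never the only critical point.

  All pairs are realized by polynomials $y^4 + Q(x) y^2 + P(x)$, whose critical points are those of $P$ on
  the axis $y = 0$ and, where $Q < 0$, the two points $y = \pm\sqrt{-Q/2}$ over each critical point of
  $R = P - Q^2/4$. A local maximum is a maximum of $P$ at which $Q < 0$.
\<close>

section \<open>The resultant of a monic cubic and a quadratic\<close>

text \<open>The resultant in Y of \<open>Y^3 + b*Y^2 + c*Y + d\<close> and
  \<open>p*Y^2 + q*Y + r\<close>, written out in the coefficients so that it makes sense over any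
  commutative ring. It is applied to coefficients that are themselves polynomials in x.\<close>

definition res32 :: "'a::comm_ring_1 \<Rightarrow> 'a \<Rightarrow> 'a \<Rightarrow> 'a \<Rightarrow> 'a \<Rightarrow> 'a \<Rightarrow> 'a" where
  "res32 b c d p q r = p^3*d^2 - p^2*q*c*d + p^2*r*(c^2-2*b*d) + p*q^2*b*d + p*q*r*(3*d-b*c)
    + p*r^2*(b^2-2*c) - q^3*d + q^2*r*c - q*r^2*b + r^3"

lemma res32_roots:
  fixes x y z :: "'a::comm_ring_1"
  shows "res32 (-(x+y+z)) (x*y+y*z+x*z) (-(x*y*z)) p q r
    = (p*x^2+q*x+r) * (p*y^2+q*y+r) * (p*z^2+q*z+r)"
  unfolding res32_def by (simp add: power2_eq_square power3_eq_cube algebra_simps)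

lemma poly_res32:
  fixes b c d p q r :: "'a::idom poly"
  shows "poly (res32 b c d p q r) x = res32 (poly b x) (poly c x) (poly d x) (poly p x) (poly q x) (poly r x)"
  by (simp add: res32_def)

text \<open>The assumptions say that at x the cubic is \<open>(Y - y) * (Y^2 + u*Y + v)\<close> and
  the quadratic is \<open>(Y - y) * (p*Y + h)\<close>. The first factor of the derivative is the
  resultant of the two cofactors; the second is the Jacobian determinant of the two equations at (x,
  y).\<close>

lemma poly_pderiv_res32_common_root:
  fixes b c d p q r :: "'a::idom poly"
  assumes "poly b x = u - y" "poly c x = v - y*u" "poly d x = - y * v"
    "poly q x = h - poly p x * y" "poly r x = - y*h"
  shows "poly (pderiv (res32 b c d p q r)) x =
    ((poly p x)^2 * v - poly p x*h*u + h^2) *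
    ((y^2+u*y+v) * (poly (pderiv p) x * y^2 + poly (pderiv q) x * y + poly (pderiv r) x)
     - (poly p x*y + h) * (poly (pderiv b) x * y^2 + poly (pderiv c) x * y + poly (pderiv d) x))"
proof -
  have *: "poly (pderiv (2 * s)) x = 2 * poly (pderiv s) x"
    "poly (pderiv (3 * s)) x = 3 * poly (pderiv s) x" for s :: "'a poly"
    by (simp_all only: numeral_poly pderiv_mult pderiv_pCons) simp_all
  show ?thesis
    unfolding res32_def using assms
    by (simp add: pderiv_add pderiv_diff pderiv_minus pderiv_mult power2_eq_square power3_eq_cube *)
      (simp add: algebra_simps)
qed

section \<open>Leading coefficient of the resultant\<close>

lemma coeff_mult_degree_le:
  assumes "degree p \<le> m" "degree q \<le> n"
  shows "coeff (p*q) (m+n) = coeff p m * coeff q n"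
proof -
  have "coeff (p*q) (m+n) = (\<Sum>i\<le>m+n. coeff p i * coeff q (m+n-i))"
    by (rule coeff_mult)
  also have "\<dots> = (\<Sum>i\<in>{m}. coeff p i * coeff q (m+n-i))"
  proof (rule sum.mono_neutral_right)
    show "\<forall>i\<in>{..m+n} - {m}. coeff p i * coeff q (m+n-i) = 0"
    proof
      fix i assume i: "i \<in> {..m+n} - {m}"
      then consider "i > m" | "m+n-i > n" by force
      then show "coeff p i * coeff q (m+n-i) = 0"
        using assms by cases (simp_all add: coeff_eq_0)
    qed
  qed auto
  finally show ?thesis by simp
qed

text \<open>The value \<open>a\<close> may be 0, so the predicate passes through sums, differences
  and products without any condition about cancellation.\<close>

definition lead_at :: "nat \<Rightarrow> 'a::idom poly \<Rightarrow> 'a \<Rightarrow> bool" where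
  "lead_at n p a \<longleftrightarrow> degree p \<le> n \<and> coeff p n = a"

lemma lead_at_add: "lead_at n p a \<Longrightarrow> lead_at n q b \<Longrightarrow> lead_at n (p+q) (a+b)"
  and lead_at_diff: "lead_at n p a \<Longrightarrow> lead_at n q b \<Longrightarrow> lead_at n (p-q) (a-b)"
  by (auto simp: lead_at_def intro: degree_add_le degree_diff_le)

lemma lead_at_mult: "lead_at m p a \<Longrightarrow> lead_at n q b \<Longrightarrow> k = m + n \<Longrightarrow> lead_at k (p*q) (a*b)"
  by (auto simp: lead_at_def coeff_mult_degree_le intro: order_trans[OF degree_mult_le])

lemma lead_at_power: "lead_at m p a \<Longrightarrow> n = k*m \<Longrightarrow> lead_at n (p^k) (a^k)"
proof (induction k arbitrary: n)
  case 0 then show ?case by (simp add: lead_at_def)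
next
  case (Suc k) then show ?case using lead_at_mult[of m p a "k*m" "p^k" "a^k"] by simp
qed

lemma lead_at_numeral: "lead_at 0 (numeral k) (numeral k)"
  by (simp add: lead_at_def numeral_poly)

text \<open>With weights 1, 2, 3 for b, c, d and likewise for p, q, r, every monomial of
  \<open>res32\<close> has weight 9.\<close>

lemma lead_at_res32:
  assumes "lead_at 1 b b'" "lead_at 2 c c'" "lead_at 3 d d'" "lead_at 1 p p'" "lead_at 2 q q'" "lead_at 3 r r'"
  shows "lead_at 9 (res32 b c d p q r) (res32 b' c' d' p' q' r')"
  unfolding res32_def
  by ((rule assms lead_at_add lead_at_diff lead_at_mult lead_at_power lead_at_numeral | simp)+)

section \<open>Roots of real and complex univariate polynomials\<close>

lemma odd_degree_real_root:
  fixes p :: "real poly"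
  assumes "odd (degree p)"
  shows "\<exists>x. poly p x = 0"
proof -
  have *: "\<exists>x. poly p x = 0" if "odd (degree p)" "lead_coeff p > 0" for p :: "real poly"
  proof -
    obtain n where n: "\<And>x. x \<ge> n \<Longrightarrow> poly p x \<ge> lead_coeff p"
      using poly_pinfty_gt_lc[OF \<open>lead_coeff p > 0\<close>] by blast
    \<comment> \<open>This is -p(-x). As the degree is odd it has the same leading coefficient as
      \<open>p\<close>, so its growth at infinity shows that \<open>p\<close> is negative far to the
      left.\<close>
    define q where "q = - (p \<circ>\<^sub>p [:0, -1:])"
    have "lead_coeff q = lead_coeff p"
      using \<open>odd (degree p)\<close> by (simp add: q_def lead_coeff_comp)
    then obtain m where m: "\<And>x. x \<ge> m \<Longrightarrow> poly q x \<ge> lead_coeff p"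
      using poly_pinfty_gt_lc[of q] \<open>lead_coeff p > 0\<close> by auto
    define t where "t = max 1 (max m n)"
    have t: "n \<le> t" "m \<le> t" "1 \<le> t" by (simp_all add: t_def)
    have "poly p t > 0" using n[OF t(1)] \<open>lead_coeff p > 0\<close> by linarith
    moreover have "poly p (-t) < 0"
      using m[OF t(2)] \<open>lead_coeff p > 0\<close> by (simp add: q_def poly_pcompose)
    ultimately show ?thesis using t(3) poly_IVT_pos[of "-t" t p] by auto
  qed
  have "lead_coeff p \<noteq> 0" using assms by auto
  then consider "lead_coeff p > 0" | "lead_coeff (-p) > 0" by fastforce
  then show ?thesis using *[of p] *[of "-p"] assms by cases auto
qed

text \<open>Splitting off a real root, which is simple, lowers both the degree and the number of
  real roots by one. When no real root is left, the degree is even.\<close>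

lemma card_real_roots_parity:
  fixes p :: "real poly"
  assumes "p \<noteq> 0" "\<And>x. poly p x = 0 \<Longrightarrow> poly (pderiv p) x \<noteq> 0"
  shows "even (card {x. poly p x = 0} + degree p)"
  using assms
proof (induction "degree p" arbitrary: p rule: less_induct)
  case less
  show ?case
  proof (cases "\<exists>x. poly p x = 0")
    case False
    then have "even (degree p)" using odd_degree_real_root by blast
    moreover have "{x. poly p x = 0} = {}" using False by auto
    ultimately show ?thesis by simp
  next
    case True
    then obtain a q where a: "poly p a = 0" and p: "p = [:-a, 1:] * q"
      by (auto simp: poly_eq_0_iff_dvd dvd_def)
    with less.prems have q0: "q \<noteq> 0" by auto
    have dp: "degree p = Suc (degree q)"
      unfolding p using q0 by (subst degree_mult_eq) auto
    have qa: "poly q a \<noteq> 0"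
      using less.prems(2)[OF a] unfolding p pderiv_mult by (simp add: pderiv_pCons)
    have "poly (pderiv q) x \<noteq> 0" if "poly q x = 0" for x
      using less.prems(2)[of x] that unfolding p pderiv_mult by auto
    then have IH: "even (card {x. poly q x = 0} + degree q)"
      using less.hyps[of q] dp q0 by auto
    have "{x. poly p x = 0} = insert a {x. poly q x = 0}" unfolding p by auto
    moreover have "finite {x. poly q x = 0}" using q0 by (rule poly_roots_finite)
    ultimately have "card {x. poly p x = 0} = Suc (card {x. poly q x = 0})"
      using qa by simp
    then show ?thesis using IH dp by simp
  qed
qed

lemma complex_cubic_roots:
  fixes b c d :: complex
  obtains x y z where "b = -(x+y+z)" "c = x*y+y*z+x*z" "d = -(x*y*z)"
proof -
  obtain x where x: "poly [:d, c, b, 1:] x = 0"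
    using alg_closed_imp_poly_has_root[of "[:d, c, b, 1:]"] by auto
  \<comment> \<open>The quotient of the cubic by \<open>Y - x\<close>. The third root is then forced
    by the sum of the roots.\<close>
  obtain y where y: "poly [:c + x*(b+x), b+x, 1:] y = 0"
    using alg_closed_imp_poly_has_root[of "[:c + x*(b+x), b+x, 1:]"] by auto
  have "b = -(x+y+(-(b+x+y)))" by simp
  moreover have "c = x*y+y*(-(b+x+y))+x*(-(b+x+y))" using y by (simp add: algebra_simps add_eq_0_iff2)
  moreover have "d = -(x*y*(-(b+x+y)))" using x y by simp algebra
  ultimately show ?thesis by (rule that)
qed

section \<open>Partial derivatives and shears\<close>

lemma peval_expand:
  fixes x y :: "'a::real_field"
  assumes "supp4 c"
  shows "peval c x y = of_real (c 0 0) + of_real (c 0 1) * y + of_real (c 0 2) * y^2 + of_real (c 0 3) * y^3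
    + of_real (c 0 4) * y^4 + of_real (c 1 0) * x + of_real (c 1 1) * x * y + of_real (c 1 2) * x * y^2
    + of_real (c 1 3) * x * y^3 + of_real (c 2 0) * x^2 + of_real (c 2 1) * x^2 * y + of_real (c 2 2) * x^2 * y^2
    + of_real (c 3 0) * x^3 + of_real (c 3 1) * x^3 * y + of_real (c 4 0) * x^4"
  unfolding peval_def by (simp add: numeral_eq_Suc)

lemma supp4_dx: "supp4 c \<Longrightarrow> supp4 (dx c)" and supp4_dy: "supp4 c \<Longrightarrow> supp4 (dy c)"
  by (auto simp: supp4_def dx_def dy_def)

lemma supp4_zero:
  assumes "supp4 c" "4 < i + j" shows "c i j = 0"
  using assms by (simp add: supp4_def)


lemma peval_dx:
  fixes x y :: "'a::real_field"
  assumes "supp4 c"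
  shows "peval (dx c) x y = of_real (c 1 0) + of_real (c 1 1) * y + of_real (c 1 2) * y^2 + of_real (c 1 3) * y^3
    + 2 * of_real (c 2 0) * x + 2 * of_real (c 2 1) * x * y + 2 * of_real (c 2 2) * x * y^2
    + 3 * of_real (c 3 0) * x^2 + 3 * of_real (c 3 1) * x^2 * y + 4 * of_real (c 4 0) * x^3"
  unfolding peval_expand[OF supp4_dx[OF assms]]
  by (simp add: dx_def supp4_zero[OF assms] numeral_2_eq_2[symmetric] numeral_3_eq_3[symmetric] flip: One_nat_def)

lemma peval_dy:
  fixes x y :: "'a::real_field"
  assumes "supp4 c"
  shows "peval (dy c) x y = of_real (c 0 1) + 2 * of_real (c 0 2) * y + 3 * of_real (c 0 3) * y^2
    + 4 * of_real (c 0 4) * y^3 + of_real (c 1 1) * x + 2 * of_real (c 1 2) * x * y + 3 * of_real (c 1 3) * x * y^2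
    + of_real (c 2 1) * x^2 + 2 * of_real (c 2 2) * x^2 * y + of_real (c 3 1) * x^3"
  unfolding peval_expand[OF supp4_dy[OF assms]]
  by (simp add: dy_def supp4_zero[OF assms] numeral_2_eq_2[symmetric] numeral_3_eq_3[symmetric] flip: One_nat_def)

lemma peval_dx_dx:
  fixes x y :: "'a::real_field"
  assumes "supp4 c"
  shows "peval (dx (dx c)) x y = 2 * of_real (c 2 0) + 2 * of_real (c 2 1) * y + 2 * of_real (c 2 2) * y^2
    + 6 * of_real (c 3 0) * x + 6 * of_real (c 3 1) * x * y + 12 * of_real (c 4 0) * x^2"
  unfolding peval_dx[OF supp4_dx[OF assms]]
  by (simp add: dx_def supp4_zero[OF assms] numeral_2_eq_2[symmetric] numeral_3_eq_3[symmetric] flip: One_nat_def)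

lemma peval_dx_dy:
  fixes x y :: "'a::real_field"
  assumes "supp4 c"
  shows "peval (dx (dy c)) x y = of_real (c 1 1) + 2 * of_real (c 1 2) * y + 3 * of_real (c 1 3) * y^2
    + 2 * of_real (c 2 1) * x + 4 * of_real (c 2 2) * x * y + 3 * of_real (c 3 1) * x^2"
  unfolding peval_dx[OF supp4_dy[OF assms]]
  by (simp add: dy_def supp4_zero[OF assms] numeral_2_eq_2[symmetric] numeral_3_eq_3[symmetric] flip: One_nat_def)

lemma peval_dy_dy:
  fixes x y :: "'a::real_field"
  assumes "supp4 c"
  shows "peval (dy (dy c)) x y = 2 * of_real (c 0 2) + 6 * of_real (c 0 3) * y + 12 * of_real (c 0 4) * y^2
    + 2 * of_real (c 1 2) * x + 6 * of_real (c 1 3) * x * y + 2 * of_real (c 2 2) * x^2"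
  unfolding peval_dy[OF supp4_dy[OF assms]]
  by (simp add: dy_def supp4_zero[OF assms] numeral_2_eq_2[symmetric] numeral_3_eq_3[symmetric] flip: One_nat_def)

lemma top4_expand:
  fixes x y :: "'a::real_field"
  shows "top4 c x y = of_real (c 0 4) * y^4 + of_real (c 1 3) * x * y^3 + of_real (c 2 2) * x^2 * y^2
    + of_real (c 3 1) * x^3 * y + of_real (c 4 0) * x^4"
  unfolding top4_def by (simp add: numeral_eq_Suc)

lemma peval_of_real: "peval c (of_real x) (of_real y) = (of_real (peval c x y) :: 'a::real_field)"
  by (simp add: peval_def)

lemma cnj_peval: "cnj (peval c z w) = peval c (cnj z) (cnj w)"
  by (simp add: peval_def)

lemma complex_crit_of_real:
  "complex_crit c (of_real x) (of_real y) \<longleftrightarrow> (x, y) \<in> real_crit_points c"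
  by (simp add: complex_crit_def real_crit_points_def peval_of_real)

lemma complex_crit_cnj: "complex_crit c z w \<Longrightarrow> complex_crit c (cnj z) (cnj w)"
  by (simp add: complex_crit_def flip: cnj_peval)

lemma hess_det_of_real: "hess_det c (of_real x) (of_real y) = (of_real (hess_det c x y) :: 'a::real_field)"
  by (simp add: hess_det_def peval_of_real)

text \<open>Coefficients of the sheared polynomial (x, y) \<mapsto> f (x + t y, y).\<close>

definition shear :: "real \<Rightarrow> (nat \<Rightarrow> nat \<Rightarrow> real) \<Rightarrow> nat \<Rightarrow> nat \<Rightarrow> real" where
  "shear t c k l = (\<Sum>d\<le>l. real ((k + d) choose d) * t^d * c (k + d) (l - d))"

lemma supp4_shear: "supp4 c \<Longrightarrow> supp4 (shear t c)"
  unfolding supp4_def shear_def by (auto intro!: sum.neutral)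

lemma shear_simps:
  "shear t c 0 1 = c 0 1 + t * c 1 0"
  "shear t c 0 2 = c 0 2 + t * c 1 1 + t^2 * c 2 0"
  "shear t c 0 3 = c 0 3 + t * c 1 2 + t^2 * c 2 1 + t^3 * c 3 0"
  "shear t c 0 4 = c 0 4 + t * c 1 3 + t^2 * c 2 2 + t^3 * c 3 1 + t^4 * c 4 0"
  "shear t c 1 0 = c 1 0"
  "shear t c 1 1 = c 1 1 + 2 * t * c 2 0"
  "shear t c 1 2 = c 1 2 + 2 * t * c 2 1 + 3 * t^2 * c 3 0"
  "shear t c 1 3 = c 1 3 + 2 * t * c 2 2 + 3 * t^2 * c 3 1 + 4 * t^3 * c 4 0"
  "shear t c 2 0 = c 2 0"
  "shear t c 2 1 = c 2 1 + 3 * t * c 3 0"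
  "shear t c 2 2 = c 2 2 + 3 * t * c 3 1 + 6 * t^2 * c 4 0"
  "shear t c 3 0 = c 3 0"
  "shear t c 3 1 = c 3 1 + 4 * t * c 4 0"
  "shear t c 4 0 = c 4 0"
  unfolding shear_def by (simp_all add: numeral_eq_Suc)

text \<open>The chain rule for f(x + t y, y): the x-derivative is unchanged, and the y-derivative
  becomes t f_x + f_y.\<close>

lemma
  fixes x y :: "'a::real_field"
  assumes "supp4 c"
  shows peval_dx_shear: "peval (dx (shear t c)) x y = peval (dx c) (x + of_real t * y) y"
    and peval_dy_shear: "peval (dy (shear t c)) x y =
        of_real t * peval (dx c) (x + of_real t * y) y + peval (dy c) (x + of_real t * y) y"
    and peval_dx_dx_shear: "peval (dx (dx (shear t c))) x y = peval (dx (dx c)) (x + of_real t * y) y"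
    and peval_dx_dy_shear: "peval (dx (dy (shear t c))) x y =
        of_real t * peval (dx (dx c)) (x + of_real t * y) y + peval (dx (dy c)) (x + of_real t * y) y"
    and peval_dy_dy_shear: "peval (dy (dy (shear t c))) x y =
        of_real t^2 * peval (dx (dx c)) (x + of_real t * y) y
        + 2 * of_real t * peval (dx (dy c)) (x + of_real t * y) y + peval (dy (dy c)) (x + of_real t * y) y"
    and top4_shear: "top4 (shear t c) x y = top4 c (x + of_real t * y) y"
  unfolding peval_dx[OF assms] peval_dx[OF supp4_shear[OF assms]]
    peval_dy[OF assms] peval_dy[OF supp4_shear[OF assms]] peval_dx_dx[OF assms] peval_dx_dx[OF supp4_shear[OF assms]]
    peval_dx_dy[OF assms] peval_dx_dy[OF supp4_shear[OF assms]] peval_dy_dy[OF assms] peval_dy_dy[OF supp4_shear[OF assms]]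
    top4_expand shear_simps
  by (simp_all add: algebra_simps power2_eq_square power3_eq_cube power4_eq_xxxx)

text \<open>A shear has determinant 1, so it preserves the Hessian determinant.\<close>

lemma hess_det_shear:
  fixes x y :: "'a::real_field"
  assumes "supp4 c"
  shows "hess_det (shear t c) x y = hess_det c (x + of_real t * y) y"
  unfolding hess_det_def peval_dx_dx_shear[OF assms] peval_dx_dy_shear[OF assms] peval_dy_dy_shear[OF assms]
  by (simp add: algebra_simps power2_eq_square)

lemma complex_crit_shear:
  assumes "supp4 c"
  shows "complex_crit (shear t c) z w \<longleftrightarrow> complex_crit c (z + of_real t * w) w"
  by (auto simp: complex_crit_def peval_dx_shear[OF assms] peval_dy_shear[OF assms])

lemma nondegenerate4_shear:
  assumes "supp4 c" "nondegenerate4 c"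
  shows "nondegenerate4 (shear t c)"
proof -
  obtain a b :: "nat \<Rightarrow> complex" where
    ab: "\<And>k l. k < 4 \<Longrightarrow> l < 4 \<Longrightarrow> k \<noteq> l \<Longrightarrow> a k * b l - a l * b k \<noteq> 0"
    and top: "\<And>z w. top4 c z w = (\<Prod>k<4. a k * z + b k * w)"
    using assms(2) unfolding nondegenerate4_def by blast
  define b' where "b' k = of_real t * a k + b k" for k
  have "a k * b' l - a l * b' k \<noteq> 0" if "k < 4" "l < 4" "k \<noteq> l" for k l
    using ab[OF that] by (simp add: b'_def algebra_simps)
  moreover have "top4 (shear t c) z w = (\<Prod>k<4. a k * z + b' k * w)" for z w
    unfolding top4_shear[OF assms(1)] top by (simp add: b'_def algebra_simps)
  ultimately show ?thesis unfolding nondegenerate4_def by blast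
qed

lemma morse4_shear: "morse4 c \<Longrightarrow> morse4 (shear t c)"
  by (auto simp: morse4_def supp4_shear nondegenerate4_shear complex_crit_shear hess_det_shear)

lemma real_crit_points_shear:
  assumes "supp4 c"
  shows "bij_betw (\<lambda>(x, y). (x + t * y, y)) (real_crit_points (shear t c)) (real_crit_points c)"
proof (rule bij_betwI)
  show "(\<lambda>(x, y). (x + t * y, y)) \<in> real_crit_points (shear t c) \<rightarrow> real_crit_points c"
    by (auto simp: complex_crit_shear[OF assms] simp flip: complex_crit_of_real)
  show "(\<lambda>(x, y). (x - t * y, y)) \<in> real_crit_points c \<rightarrow> real_crit_points (shear t c)"
    by (auto simp: complex_crit_shear[OF assms] simp flip: complex_crit_of_real)
qed auto

section \<open>Parity of the number of critical points\<close>

text \<open>The hypotheses \<open>x\<close> and \<open>y\<close> say that both partial derivatives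
  of the quartic form vanish at (1, w). Then w is a double root of the dehomogenised form T, whereas
  the linear factors of T are pairwise non-proportional.\<close>

lemma nondegenerate4_no_common_zero:
  assumes "nondegenerate4 c"
    and x: "of_real (c 1 3) * w^3 + 2 * of_real (c 2 2) * w^2 + 3 * of_real (c 3 1) * w
      + 4 * of_real (c 4 0) = (0::complex)"
    and y: "4 * of_real (c 0 4) * w^3 + 3 * of_real (c 1 3) * w^2 + 2 * of_real (c 2 2) * w + of_real (c 3 1) = 0"
  shows False
proof -
  obtain a b :: "nat \<Rightarrow> complex" where
    ab: "\<And>k l. k < 4 \<Longrightarrow> l < 4 \<Longrightarrow> k \<noteq> l \<Longrightarrow> a k * b l - a l * b k \<noteq> 0"
    and top: "\<And>z w. top4 c z w = (\<Prod>k<4. a k * z + b k * w)"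
    using assms(1) unfolding nondegenerate4_def by blast
  define T :: "complex poly" where
    "T = [:of_real (c 4 0), of_real (c 3 1), of_real (c 2 2), of_real (c 1 3), of_real (c 0 4):]"
  have "poly T u = poly (\<Prod>k<4. [:a k, b k:]) u" for u
    using top[of 1 u] unfolding T_def top4_expand
    by (simp add: poly_prod algebra_simps power2_eq_square power3_eq_cube power4_eq_xxxx)
  then have T: "T = (\<Prod>k<4. [:a k, b k:])" by (simp add: poly_eq_poly_eq_iff[symmetric] fun_eq_iff)
  \<comment> \<open>Euler's identity for a form of degree 4, evaluated at (1, w).\<close>
  have "4 * poly T w = 0" using x y unfolding T_def
    by (simp add: algebra_simps power2_eq_square power3_eq_cube) algebra
  then obtain k where k: "k < 4" and Lk: "a k + b k * w = 0"
    unfolding T by (auto simp: poly_prod algebra_simps)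
  define P where "P = (\<Prod>l\<in>{..<4}-{k}. [:a l, b l:])"
  have TP: "T = [:a k, b k:] * P" unfolding T P_def using k by (intro prod.remove) auto
  have "poly (pderiv T) w = 0" using y unfolding T_def
    by (simp add: pderiv_pCons algebra_simps power2_eq_square power3_eq_cube)
  moreover have "poly (pderiv T) w = (a k + b k * w) * poly (pderiv P) w + b k * poly P w"
    unfolding TP pderiv_mult by (simp add: pderiv_pCons algebra_simps)
  ultimately have *: "b k * poly P w = 0" using Lk by simp
  have "poly P w \<noteq> 0"
  proof
    assume "poly P w = 0"
    then obtain l where l: "l < 4" "l \<noteq> k" "a l + b l * w = 0"
      unfolding P_def by (auto simp: poly_prod algebra_simps)
    have "a k * b l - a l * b k = 0" using Lk l(3) by algebra
    then show False using ab[OF k l(1)] l(2) by auto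
  qed
  \<comment> \<open>The case \<open>b k = 0\<close> is possible for a single form, but with
    \<open>Lk\<close> it makes form k zero and hence proportional to every other form.\<close>
  with * Lk have "a k = 0" "b k = 0" by auto
  moreover obtain l :: nat where "l < 4" "l \<noteq> k" by (cases "k = 0") (auto intro: that[of 1] that[of 0])
  ultimately show False using ab[OF k, of l] by auto
qed

text \<open>The equations $f_y = 0$ and $f_x = 0$, viewed in y: the first is normalised to a monic cubic
  $y^3 + e_2 y^2 + e_1 y + e_0$ and used to reduce the second to $h_2 y^2 + h_1 y + h_0$.\<close>

definition e2 :: "(nat \<Rightarrow> nat \<Rightarrow> real) \<Rightarrow> 'a::real_field poly" where
  "e2 c = smult (of_real (1 / (4 * c 0 4))) [:of_real (3 * c 0 3), of_real (3 * c 1 3):]"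

definition e1 :: "(nat \<Rightarrow> nat \<Rightarrow> real) \<Rightarrow> 'a::real_field poly" where
  "e1 c = smult (of_real (1 / (4 * c 0 4))) [:of_real (2 * c 0 2), of_real (2 * c 1 2), of_real (2 * c 2 2):]"

definition e0 :: "(nat \<Rightarrow> nat \<Rightarrow> real) \<Rightarrow> 'a::real_field poly" where
  "e0 c = smult (of_real (1 / (4 * c 0 4))) [:of_real (c 0 1), of_real (c 1 1), of_real (c 2 1), of_real (c 3 1):]"

definition h2 :: "(nat \<Rightarrow> nat \<Rightarrow> real) \<Rightarrow> 'a::real_field poly" where
  "h2 c = [:of_real (c 1 2), of_real (2 * c 2 2):] - smult (of_real (c 1 3)) (e2 c)"

definition h1 :: "(nat \<Rightarrow> nat \<Rightarrow> real) \<Rightarrow> 'a::real_field poly" where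
  "h1 c = [:of_real (c 1 1), of_real (2 * c 2 1), of_real (3 * c 3 1):] - smult (of_real (c 1 3)) (e1 c)"

definition h0 :: "(nat \<Rightarrow> nat \<Rightarrow> real) \<Rightarrow> 'a::real_field poly" where
  "h0 c = [:of_real (c 1 0), of_real (2 * c 2 0), of_real (3 * c 3 0), of_real (4 * c 4 0):]
    - smult (of_real (c 1 3)) (e0 c)"

text \<open>The resultant in y of the two equations, as a polynomial in x. The polymorphic type lets
  the same formula be used over the reals, for counting, and over the complex numbers, for
  solving.\<close>

definition elim :: "(nat \<Rightarrow> nat \<Rightarrow> real) \<Rightarrow> 'a::real_field poly" where
  "elim c = res32 (e2 c) (e1 c) (e0 c) (h2 c) (h1 c) (h0 c)"

lemma
  fixes x y :: "'a::real_field"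
  assumes "supp4 c" "c 0 4 \<noteq> 0"
  shows peval_dy_cubic:
      "peval (dy c) x y = of_real (4 * c 0 4) * (y^3 + poly (e2 c) x * y^2 + poly (e1 c) x * y + poly (e0 c) x)"
    and peval_dx_quadratic:
      "peval (dx c) x y = of_real (c 1 3) * (y^3 + poly (e2 c) x * y^2 + poly (e1 c) x * y + poly (e0 c) x)
        + (poly (h2 c) x * y^2 + poly (h1 c) x * y + poly (h0 c) x)"
  unfolding peval_dx[OF assms(1)] peval_dy[OF assms(1)] h2_def h1_def h0_def e2_def e1_def e0_def
  using assms(2) by (simp_all add: field_simps power2_eq_square power3_eq_cube)

lemma crit_iff:
  fixes x y :: "'a::real_field"
  assumes "supp4 c" "c 0 4 \<noteq> 0"
  shows "peval (dx c) x y = 0 \<and> peval (dy c) x y = 0 \<longleftrightarrow>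
    y^3 + poly (e2 c) x * y^2 + poly (e1 c) x * y + poly (e0 c) x = 0 \<and>
    poly (h2 c) x * y^2 + poly (h1 c) x * y + poly (h0 c) x = 0"
  unfolding peval_dy_cubic[OF assms] peval_dx_quadratic[OF assms] using assms(2) by auto

text \<open>The Hessian determinant is the Jacobian determinant of (f_x, f_y). Writing F for the
  monic cubic and H for the reduced quadratic, f_y = 4 \<open>c 0 4\<close> F and f_x =
  \<open>c 1 3\<close> F + H; the multiple of F drops out of the determinant.\<close>

lemma hess_det_jacobian:
  fixes x y :: "'a::real_field"
  assumes "supp4 c" "c 0 4 \<noteq> 0"
  shows "hess_det c x y = of_real (4 * c 0 4) *
    ((3 * y^2 + 2 * poly (e2 c) x * y + poly (e1 c) x) *
     (poly (pderiv (h2 c)) x * y^2 + poly (pderiv (h1 c)) x * y + poly (pderiv (h0 c)) x)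
   - (2 * poly (h2 c) x * y + poly (h1 c) x) *
     (poly (pderiv (e2 c)) x * y^2 + poly (pderiv (e1 c)) x * y + poly (pderiv (e0 c)) x))"
  unfolding hess_det_def peval_dx_dx[OF assms(1)] peval_dy_dy[OF assms(1)] peval_dx_dy[OF assms(1)]
    h2_def h1_def h0_def e2_def e1_def e0_def pderiv_diff pderiv_smult
  using assms(2)
  by (simp add: pderiv_pCons) (simp add: field_simps power2_eq_square power3_eq_cube)

text \<open>The coefficient at degree 9 is the same resultant formed from the quartic part alone. If
  it vanished, the partial derivatives of the quartic part would have a common zero, that is, a
  critical point at infinity.\<close>

lemma degree_elim:
  assumes "nondegenerate4 c" "c 0 4 \<noteq> 0"
  shows "degree (elim c :: 'a::real_field poly) = 9"
proof -
  define k where "k = 1 / (4 * c 0 4)"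
  define K where "K = res32 (k * (3 * c 1 3)) (k * (2 * c 2 2)) (k * c 3 1)
    (2 * c 2 2 - c 1 3 * (k * (3 * c 1 3))) (3 * c 3 1 - c 1 3 * (k * (2 * c 2 2))) (4 * c 4 0 - c 1 3 * (k * c 3 1))"
  have "lead_at 9 (elim c :: 'a poly) (res32 (of_real (k * (3 * c 1 3))) (of_real (k * (2 * c 2 2))) (of_real (k * c 3 1))
    (of_real (2 * c 2 2 - c 1 3 * (k * (3 * c 1 3)))) (of_real (3 * c 3 1 - c 1 3 * (k * (2 * c 2 2))))
    (of_real (4 * c 4 0 - c 1 3 * (k * c 3 1))))"
    unfolding elim_def
    by (rule lead_at_res32)
      (auto simp: lead_at_def e2_def e1_def e0_def h2_def h1_def h0_def k_def eval_nat_numeral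
        intro!: degree_diff_le order_trans[OF degree_smult_le])
  then have lead_at: "lead_at 9 (elim c :: 'a poly) (of_real K)" by (simp add: K_def res32_def)
  \<comment> \<open>\<open>K\<close> is a real number, so it suffices to show that it is nonzero
    over the complex numbers, where the cubic splits and \<open>res32_roots\<close> applies.\<close>
  have "(of_real K :: complex) \<noteq> 0"
  proof
    assume K0: "(of_real K :: complex) = 0"
    define b d e p q r :: complex where "b = of_real (k * (3 * c 1 3))" and "d = of_real (k * (2 * c 2 2))"
      and "e = of_real (k * c 3 1)" and "p = of_real (2 * c 2 2 - c 1 3 * (k * (3 * c 1 3)))"
      and "q = of_real (3 * c 3 1 - c 1 3 * (k * (2 * c 2 2)))" and "r = of_real (4 * c 4 0 - c 1 3 * (k * c 3 1))"
    have "of_real K = res32 b d e p q r"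
      unfolding K_def b_def d_def e_def p_def q_def r_def by (simp add: res32_def)
    moreover obtain x y z where xyz: "b = -(x+y+z)" "d = x*y+y*z+x*z" "e = -(x*y*z)"
      by (rule complex_cubic_roots)
    ultimately have "(p*x^2+q*x+r) * (p*y^2+q*y+r) * (p*z^2+q*z+r) = 0" using K0 by (simp only: res32_roots)
    then obtain w where w: "w \<in> {x, y, z}" "p*w^2+q*w+r = 0" by auto
    have F: "w^3 + b*w^2 + d*w + e = 0"
    proof -
      have "w^3 + b*w^2 + d*w + e = (w-x)*(w-y)*(w-z)" unfolding xyz by algebra
      then show ?thesis using w(1) by auto
    qed
    have "4 * of_real (c 0 4) * (w^3 + b*w^2 + d*w + e) =
       4 * of_real (c 0 4) * w^3 + 3 * of_real (c 1 3) * w^2 + 2 * of_real (c 2 2) * w + of_real (c 3 1)"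
      using assms(2) by (simp add: b_def d_def e_def k_def field_simps)
    moreover have "of_real (c 1 3) * (w^3 + b*w^2 + d*w + e) + (p*w^2+q*w+r) =
        of_real (c 1 3) * w^3 + 2 * of_real (c 2 2) * w^2 + 3 * of_real (c 3 1) * w + 4 * of_real (c 4 0)"
      by (simp add: b_def d_def e_def p_def q_def r_def algebra_simps)
    ultimately show False using nondegenerate4_no_common_zero[OF assms(1), of w] F w(2) by simp
  qed
  then have "coeff (elim c :: 'a poly) 9 \<noteq> 0" using lead_at by (simp add: lead_at_def)
  then show ?thesis using lead_at le_degree[of "elim c :: 'a poly" 9] by (simp add: lead_at_def)
qed

lemma poly_elim_of_real: "poly (elim c) (of_real x) = (of_real (poly (elim c) x) :: 'a::real_field)"
  by (simp add: elim_def poly_res32 res32_def e2_def e1_def e0_def h2_def h1_def h0_def)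

text \<open>Over the complex numbers the monic cubic splits, and the resultant is the product of the
  values of the quadratic at its three roots.\<close>

lemma complex_root_elim_iff:
  assumes "supp4 c" "c 0 4 \<noteq> 0"
  shows "poly (elim c) z = 0 \<longleftrightarrow> (\<exists>w. complex_crit c z w)"
proof -
  obtain x y u where e: "poly (e2 c) z = -(x+y+u)" "poly (e1 c) z = x*y+y*u+x*u" "poly (e0 c) z = -(x*y*u)"
    by (rule complex_cubic_roots)
  have F: "w^3 + poly (e2 c) z * w^2 + poly (e1 c) z * w + poly (e0 c) z = (w-x)*(w-y)*(w-u)" for w
    unfolding e by algebra
  show ?thesis
    unfolding complex_crit_def crit_iff[OF assms] F
    unfolding elim_def poly_res32 e res32_roots by auto
qed

text \<open>The first coordinates are roots of \<open>elim c\<close>, and over each of them the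
  second coordinates are roots of a monic cubic. Finiteness is what makes a separating shear
  available.\<close>

lemma finite_complex_crit:
  assumes "morse4 c" "c 0 4 \<noteq> 0"
  shows "finite {(z, w). complex_crit c z w}"
proof -
  have s: "supp4 c" and n: "nondegenerate4 c" using assms(1) by (auto simp: morse4_def)
  have "elim c \<noteq> (0 :: complex poly)" using degree_elim[OF n assms(2), where 'a = complex] by auto
  then have fin: "finite {z :: complex. poly (elim c) z = 0}" by (rule poly_roots_finite)
  have "finite {w. poly [:poly (e0 c) z, poly (e1 c) z, poly (e2 c) z, 1:] w = 0}" for z :: complex
    by (intro poly_roots_finite) auto
  with fin have "finite (SIGMA z:{z::complex. poly (elim c) z = 0}.
      {w. poly [:poly (e0 c) z, poly (e1 c) z, poly (e2 c) z, 1:] w = 0})" by (rule finite_SigmaI)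
  moreover have "{(z, w). complex_crit c z w} \<subseteq> (SIGMA z:{z::complex. poly (elim c) z = 0}.
      {w. poly [:poly (e0 c) z, poly (e1 c) z, poly (e2 c) z, 1:] w = 0})"
    using complex_root_elim_iff[OF s assms(2)]
    by (auto simp: complex_crit_def crit_iff[OF s assms(2)] algebra_simps power2_eq_square power3_eq_cube)
  ultimately show ?thesis by (rule rev_finite_subset)
qed

text \<open>By \<open>poly_pderiv_res32_common_root\<close> the derivative is the resultant of the
  cofactors times the Jacobian. The Jacobian is nonzero by the Morse condition; a vanishing
  resultant of the cofactors would produce a further critical point over x, or the same one doubly,
  which contradicts the Jacobian.\<close>

lemma simple_root_elim:
  assumes "morse4 c" "c 0 4 \<noteq> 0" and xy: "(x, y) \<in> real_crit_points c"
    and uniq: "\<And>w. complex_crit c (of_real x) w \<Longrightarrow> w = of_real y"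
  shows "poly (pderiv (elim c)) x \<noteq> 0"
proof -
  have s: "supp4 c" using assms(1) by (auto simp: morse4_def)
  define p where "p = poly (h2 c) x"
  \<comment> \<open>The quotients after dividing out the common root y: \<open>Y^2 + u*Y + v\<close>
    for the cubic and \<open>p*Y + h\<close> for the quadratic.\<close>
  define u where "u = poly (e2 c) x + y"
  define v where "v = poly (e1 c) x + y * u"
  define h where "h = poly (h1 c) x + p * y"
  have crit: "y^3 + poly (e2 c) x * y^2 + poly (e1 c) x * y + poly (e0 c) x = 0"
    "poly (h2 c) x * y^2 + poly (h1 c) x * y + poly (h0 c) x = 0"
    using xy unfolding real_crit_points_def by (auto simp: crit_iff[OF s assms(2)])
  have eqs: "poly (e2 c) x = u - y" "poly (e1 c) x = v - y * u" "poly (e0 c) x = - y * v"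
    "poly (h1 c) x = h - poly (h2 c) x * y" "poly (h0 c) x = - y * h"
    using crit by (auto simp: u_def v_def h_def p_def algebra_simps power2_eq_square power3_eq_cube)
  have "hess_det c (of_real x :: complex) (of_real y) \<noteq> 0"
    using assms(1) xy by (auto simp: morse4_def complex_crit_of_real)
  then have "hess_det c x y \<noteq> 0" by (simp add: hess_det_of_real)
  moreover have *: "3 * y^2 + 2 * poly (e2 c) x * y + poly (e1 c) x = y^2 + u*y + v"
    "2 * poly (h2 c) x * y + poly (h1 c) x = p * y + h"
    unfolding eqs by (simp_all add: p_def algebra_simps power2_eq_square)
  ultimately have J: "(y^2 + u*y + v) *
     (poly (pderiv (h2 c)) x * y^2 + poly (pderiv (h1 c)) x * y + poly (pderiv (h0 c)) x)
   - (p * y + h) *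
     (poly (pderiv (e2 c)) x * y^2 + poly (pderiv (e1 c)) x * y + poly (pderiv (e0 c)) x) \<noteq> 0"
    by (simp add: hess_det_jacobian[OF s assms(2)] *)
  have "p^2 * v - p * h * u + h^2 \<noteq> 0"
  proof
    assume N: "p^2 * v - p * h * u + h^2 = 0"
    \<comment> \<open>A common zero of the two cofactors. If \<open>p = 0\<close>, then
      \<open>N\<close> forces \<open>h = 0\<close>, the linear cofactor vanishes identically, and
      any root of the other one serves; that root may be non-real.\<close>
    obtain w :: complex where w: "w^2 + of_real u * w + of_real v = 0" "of_real p * w + of_real h = 0"
    proof (cases "p = 0")
      case True
      then have "h = 0" using N by simp
      have "\<not> constant (poly [:of_real v, of_real u, 1::complex:])" by (simp add: constant_degree)
      then obtain w where "poly [:of_real v, of_real u, 1::complex:] w = 0"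
        using fundamental_theorem_of_algebra by blast
      then show thesis using that[of w] True \<open>h = 0\<close> by (simp add: algebra_simps power2_eq_square)
    next
      case False
      define t where "t = - h / p"
      have "t^2 + u * t + v = (p^2 * v - p * h * u + h^2) / p^2"
        using False by (simp add: t_def field_simps power2_eq_square)
      then have "t^2 + u * t + v = 0" using N by simp
      moreover have "p * t + h = 0" using False by (simp add: t_def)
      ultimately show thesis using that[of "of_real t"] by (metis of_real_0 of_real_add of_real_mult of_real_power)
    qed
    have eqs': "poly (e2 c) (of_real x) = (of_real (poly (e2 c) x) :: complex)"
      "poly (e1 c) (of_real x) = (of_real (poly (e1 c) x) :: complex)"
      "poly (e0 c) (of_real x) = (of_real (poly (e0 c) x) :: complex)"
      "poly (h2 c) (of_real x) = (of_real (poly (h2 c) x) :: complex)"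
      "poly (h1 c) (of_real x) = (of_real (poly (h1 c) x) :: complex)"
      "poly (h0 c) (of_real x) = (of_real (poly (h0 c) x) :: complex)"
      by (simp_all add: e2_def e1_def e0_def h2_def h1_def h0_def)
    have "complex_crit c (of_real x) w"
    proof -
      have "w^3 + of_real (u - y) * w^2 + of_real (v - y * u) * w + of_real (- y * v)
          = (w - of_real y) * (w^2 + of_real u * w + of_real v)"
        by (simp add: algebra_simps power2_eq_square power3_eq_cube)
      moreover have "of_real p * w^2 + of_real (h - p * y) * w + of_real (- y * h)
          = (w - of_real y) * (of_real p * w + of_real h)"
        by (simp add: algebra_simps power2_eq_square power3_eq_cube)
      ultimately show ?thesis
        unfolding complex_crit_def crit_iff[OF s assms(2)] eqs' eqs using w
        by (simp add: p_def)
    qed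
    \<comment> \<open>Now both cofactors vanish at y, so both summands of \<open>J\<close>
      vanish.\<close>
    then have "w = of_real y" by (rule uniq)
    then have "of_real (y^2 + u * y + v) = (0::complex)" "of_real (p * y + h) = (0::complex)"
      using w by simp_all
    then have "y^2 + u * y + v = 0" "p * y + h = 0" by (simp_all only: of_real_eq_0_iff)
    then show False using J by simp
  qed
  moreover have "poly (pderiv (elim c)) x = (p^2 * v - p * h * u + h^2) * ((y^2 + u*y + v) *
     (poly (pderiv (h2 c)) x * y^2 + poly (pderiv (h1 c)) x * y + poly (pderiv (h0 c)) x)
   - (p * y + h) *
     (poly (pderiv (e2 c)) x * y^2 + poly (pderiv (e1 c)) x * y + poly (pderiv (e0 c)) x))"
    unfolding elim_def p_def by (rule poly_pderiv_res32_common_root) (rule eqs)+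
  ultimately show ?thesis using J by simp
qed

text \<open>Under \<open>H\<close> the first coordinate maps the real critical points bijectively
  onto the real roots of a real polynomial of degree 9 with simple real roots.\<close>

lemma crit_count_aux:
  assumes "morse4 c" "c 0 4 \<noteq> 0"
    and H: "\<And>z w w'. complex_crit c z w \<Longrightarrow> complex_crit c z w' \<Longrightarrow> w = w'"
  shows "odd (card (real_crit_points c)) \<and> card (real_crit_points c) \<le> 9"
proof -
  have s: "supp4 c" and n: "nondegenerate4 c" using assms(1) by (auto simp: morse4_def)
  define \<rho> where "\<rho> = (elim c :: real poly)"
  have deg: "degree \<rho> = 9" unfolding \<rho>_def by (rule degree_elim[OF n assms(2)])
  then have "\<rho> \<noteq> 0" by auto
  have root: "\<exists>y. (x, y) \<in> real_crit_points c" if "poly \<rho> x = 0" for x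
  proof -
    have "poly (elim c) (of_real x) = (0::complex)" using that by (simp add: \<rho>_def poly_elim_of_real)
    then obtain w where w: "complex_crit c (of_real x) w" using complex_root_elim_iff[OF s assms(2)] by blast
    \<comment> \<open>Over a real x the conjugate of a critical point is again critical with the
      same first coordinate, so uniqueness makes w real.\<close>
    then have "cnj w = w" using H complex_crit_cnj by (metis complex_cnj_complex_of_real)
    then have "w = of_real (Re w)" by (simp add: complex_eq_iff)
    then show ?thesis using w complex_crit_of_real by metis
  qed
  have root': "poly \<rho> x = 0" if "(x, y) \<in> real_crit_points c" for x y
  proof -
    have "complex_crit c (of_real x) (of_real y)" using that by (simp add: complex_crit_of_real)
    then have "poly (elim c) (of_real x) = (0::complex)" using complex_root_elim_iff[OF s assms(2)] by blast
    then show ?thesis by (simp add: \<rho>_def poly_elim_of_real)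
  qed
  have inj: "inj_on fst (real_crit_points c)"
  proof (rule inj_onI, clarsimp)
    fix x y y' assume "(x, y) \<in> real_crit_points c" "(x, y') \<in> real_crit_points c"
    then have "complex_of_real y = of_real y'" by (intro H[of "of_real x"]) (simp_all add: complex_crit_of_real)
    then show "y = y'" by simp
  qed
  have img: "fst ` real_crit_points c = {x. poly \<rho> x = 0}" using root root' by force
  have "even (card {x. poly \<rho> x = 0} + degree \<rho>)"
  proof (rule card_real_roots_parity[OF \<open>\<rho> \<noteq> 0\<close>])
    fix x assume "poly \<rho> x = 0"
    then obtain y where y: "(x, y) \<in> real_crit_points c" using root by blast
    show "poly (pderiv \<rho>) x \<noteq> 0" unfolding \<rho>_def
      using y by (intro simple_root_elim[OF assms(1,2) y] H[of "of_real x"]) (simp_all add: complex_crit_of_real)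
  qed
  moreover have "card {x. poly \<rho> x = 0} \<le> 9" using card_poly_roots_bound[OF \<open>\<rho> \<noteq> 0\<close>] deg by simp
  moreover have "card (real_crit_points c) = card {x. poly \<rho> x = 0}" using card_image[OF inj] img by simp
  ultimately show ?thesis using deg by simp
qed

lemma crit_count:
  assumes "morse4 c" and pos: "\<And>x y :: real. (x, y) \<noteq> (0, 0) \<Longrightarrow> top4 c x y > 0"
  shows "odd (card (real_crit_points c)) \<and> card (real_crit_points c) \<le> 9"
proof -
  have s: "supp4 c" using assms(1) by (auto simp: morse4_def)
  define Z where "Z = {(z, w). complex_crit c z w}"
  have "c 0 4 \<noteq> 0" using pos[of 0 1] by (simp add: top4_expand)
  then have "finite Z" unfolding Z_def by (intro finite_complex_crit assms)
  \<comment> \<open>A bad t is the quotient of the coordinate differences of two critical points.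
    Pairs with equal second coordinate contribute the value 0 of division by zero, and non-real
    quotients contribute their real part; excluding these finitely many extra values is
    harmless.\<close>
  then have "finite ((\<lambda>((z, w), (z', w')). Re ((z - z') / (w - w'))) ` (Z \<times> Z))" (is "finite ?B") by blast
  then obtain t where t: "t \<notin> ?B" using infinite_UNIV_char_0 ex_new_if_finite by blast
  have H: "w = w'" if "complex_crit (shear t c) z w" "complex_crit (shear t c) z w'" for z w w'
  proof (rule ccontr)
    assume "w \<noteq> w'"
    have "(z + of_real t * w, w) \<in> Z" "(z + of_real t * w', w') \<in> Z"
      using that by (auto simp: Z_def complex_crit_shear[OF s])
    moreover have "((z + of_real t * w) - (z + of_real t * w')) / (w - w') = of_real t"
      using \<open>w \<noteq> w'\<close> by (simp add: field_simps)
    ultimately have "t \<in> ?B" by (intro image_eqI[where x="((z + of_real t * w, w), (z + of_real t * w', w'))"]) auto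
    then show False using t by blast
  qed
  \<comment> \<open>This coefficient is the value of the quartic part at (t, 1), hence
    positive.\<close>
  have "shear t c 0 4 \<noteq> 0" using pos[of t 1] top4_shear[OF s, of t "0::real" 1] by (simp add: top4_expand)
  from crit_count_aux[OF morse4_shear[OF assms(1)] this H] show ?thesis
    using bij_betw_same_card[OF real_crit_points_shear[OF s, of t]] by simp
qed

section \<open>Local maxima\<close>

text \<open>Fermat's criterion gives \<open>g1 = 0\<close>. The increment is then t^2 times a factor
  tending to \<open>g2\<close>, which would be positive near 0 if \<open>g2\<close> were.\<close>

lemma quartic_local_max:
  fixes g0 g1 g2 g3 g4 e :: real
  assumes "e > 0" and max: "\<And>t. \<bar>t\<bar> < e \<Longrightarrow> g0 + g1 * t + g2 * t^2 + g3 * t^3 + g4 * t^4 \<le> g0"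
  shows "g1 = 0" "g2 \<le> 0"
proof -
  let ?g = "\<lambda>t. g0 + g1 * t + g2 * t^2 + g3 * t^3 + g4 * t^4"
  have "(?g has_real_derivative g1) (at 0)"
    by (auto intro!: derivative_eq_intros)
  then show g1: "g1 = 0"
    by (rule DERIV_local_max[OF _ \<open>e > 0\<close>]) (use max in auto)
  show "g2 \<le> 0"
  proof (rule ccontr)
    assume "\<not> g2 \<le> 0"
    have "((\<lambda>t. g2 + g3 * t + g4 * t^2) \<longlongrightarrow> g2 + g3 * 0 + g4 * 0^2) (at 0)"
      by (intro tendsto_intros)
    then have "eventually (\<lambda>t. g2 + g3 * t + g4 * t^2 > 0) (at 0)"
      using \<open>\<not> g2 \<le> 0\<close> by (intro order_tendstoD(1)[where a=0]) auto
    then obtain d where d: "d > 0" "\<And>t. t \<noteq> 0 \<Longrightarrow> \<bar>t\<bar> < d \<Longrightarrow> g2 + g3 * t + g4 * t^2 > 0"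
      by (auto simp: eventually_at)
    define t where "t = min d e / 2"
    have t: "t > 0" "\<bar>t\<bar> < d" "\<bar>t\<bar> < e" using \<open>e > 0\<close> d(1) by (auto simp: t_def)
    have "t^2 * (g2 + g3 * t + g4 * t^2) > 0" using t d(2)[of t] by simp
    then show False using max[OF t(3)] g1 by (simp add: algebra_simps power2_eq_square power3_eq_cube power4_eq_xxxx)
  qed
qed

text \<open>The exact Taylor expansion along a line: the gradient, the Hessian form and the quartic
  part appear explicitly, while the cubic coefficient stays existential because it is later
  eliminated.\<close>

lemma peval_line:
  fixes x y h k t :: real
  assumes "supp4 c"
  shows "\<exists>g3. \<forall>t. peval c (x + t * h) (y + t * k) = peval c x y
    + (peval (dx c) x y * h + peval (dy c) x y * k) * t
    + ((peval (dx (dx c)) x y * h^2 + 2 * peval (dx (dy c)) x y * h * k + peval (dy (dy c)) x y * k^2) / 2) * t^2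
    + g3 * t^3 + top4 c h k * t^4"
  unfolding peval_expand[OF assms] peval_dx[OF assms] peval_dy[OF assms] peval_dx_dx[OF assms]
    peval_dx_dy[OF assms] peval_dy_dy[OF assms] top4_expand
  by (rule exI[of _ "c 0 3 * k^3 + c 1 2 * h * k^2 + c 2 1 * h^2 * k + c 3 0 * h^3 + 4 * c 0 4 * y * k^3
     + c 1 3 * (x * k^3 + 3 * y * h * k^2) + c 2 2 * (2 * x * h * k^2 + 2 * y * h^2 * k)
     + c 3 1 * (3 * x * h^2 * k + y * h^3) + 4 * c 4 0 * x * h^3"])
    (simp add: field_simps power2_eq_square power3_eq_cube power4_eq_xxxx)

lemma local_max_line:
  assumes "supp4 c" "(x, y) \<in> local_max_points c"
  shows "peval (dx c) x y * h + peval (dy c) x y * k = 0"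
    and "peval (dx (dx c)) x y * h^2 + 2 * peval (dx (dy c)) x y * h * k + peval (dy (dy c)) x y * k^2 \<le> 0"
proof -
  obtain g3 where g3: "\<And>t. peval c (x + t * h) (y + t * k) = peval c x y
    + (peval (dx c) x y * h + peval (dy c) x y * k) * t
    + ((peval (dx (dx c)) x y * h^2 + 2 * peval (dx (dy c)) x y * h * k + peval (dy (dy c)) x y * k^2) / 2) * t^2
    + g3 * t^3 + top4 c h k * t^4"
    using peval_line[OF assms(1)] by blast
  obtain e where "e > 0" and e: "\<And>u v. (u - x)^2 + (v - y)^2 < e^2 \<Longrightarrow> peval c u v \<le> peval c x y"
    using assms(2) unfolding local_max_points_def by auto
  \<comment> \<open>A bound on the length of (h, k); the summand 1 keeps it positive when h = k =
    0.\<close>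
  define s where "s = sqrt (h^2 + k^2) + 1"
  have s: "s > 0" "h^2 + k^2 \<le> s^2" by (auto simp: s_def power2_sum add_nonneg_pos intro: add_increasing2)
  have "e / s > 0" using \<open>e > 0\<close> s by simp
  have le: "peval c (x + t * h) (y + t * k) \<le> peval c x y" if "\<bar>t\<bar> < e / s" for t
  proof (rule e)
    have "\<bar>t\<bar> * s < e" using that s by (simp add: field_simps)
    then have "(\<bar>t\<bar> * s)^2 < e^2" using s by (intro power_strict_mono) auto
    moreover have "t^2 * (h^2 + k^2) \<le> t^2 * s^2" using s by (intro mult_left_mono) auto
    ultimately show "(x + t * h - x)^2 + (y + t * k - y)^2 < e^2" by (simp add: power_mult_distrib algebra_simps)
  qed
  note q = quartic_local_max[OF \<open>e / s > 0\<close> le[unfolded g3]]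
  show "peval (dx c) x y * h + peval (dy c) x y * k = 0" using q(1) by simp
  show "peval (dx (dx c)) x y * h^2 + 2 * peval (dx (dy c)) x y * h * k + peval (dy (dy c)) x y * k^2 \<le> 0"
    using q(2) by simp
qed

lemma local_max_crit:
  assumes "supp4 c"
  shows "local_max_points c \<subseteq> real_crit_points c"
  using local_max_line(1)[OF assms, of _ _ 1 0] local_max_line(1)[OF assms, of _ _ 0 1]
  by (auto simp: real_crit_points_def)

text \<open>Expand f along the line from P to Q at both ends. Comparing coefficients and eliminating
  the cubic one gives \<open>g2 + g2' = 4 * top4 c h k\<close>, where the left side is at most 0 and
  the right side is positive.\<close>

lemma local_max_unique:
  assumes s: "supp4 c" and pos: "\<And>x y :: real. (x, y) \<noteq> (0, 0) \<Longrightarrow> top4 c x y > 0"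
    and P: "P \<in> local_max_points c" and Q: "Q \<in> local_max_points c"
  shows "P = Q"
proof (rule ccontr)
  assume "P \<noteq> Q"
  obtain x y u v where PQ: "P = (x, y)" "Q = (u, v)" by (cases P, cases Q) auto
  define h k where "h = u - x" and "k = v - y"
  define g1 g2 where "g1 = peval (dx c) x y * h + peval (dy c) x y * k"
    and "g2 = peval (dx (dx c)) x y * h^2 + 2 * peval (dx (dy c)) x y * h * k + peval (dy (dy c)) x y * k^2"
  obtain g3 where g3: "\<And>t. peval c (x + t * h) (y + t * k) =
      peval c x y + g1 * t + (g2 / 2) * t^2 + g3 * t^3 + top4 c h k * t^4"
    unfolding g1_def g2_def using peval_line[OF s] by blast
  define g1' g2' where "g1' = peval (dx c) u v * h + peval (dy c) u v * k"
    and "g2' = peval (dx (dx c)) u v * h^2 + 2 * peval (dx (dy c)) u v * h * k + peval (dy (dy c)) u v * k^2"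
  obtain g3' where g3': "\<And>t. peval c (u + t * h) (v + t * k) =
      peval c u v + g1' * t + (g2' / 2) * t^2 + g3' * t^3 + top4 c h k * t^4"
    unfolding g1'_def g2'_def using peval_line[OF s] by blast
  have 0: "g1 = 0" "g2 \<le> 0" "g1' = 0" "g2' \<le> 0"
    using local_max_line[OF s P[unfolded PQ], of h k] local_max_line[OF s Q[unfolded PQ], of h k]
    by (simp_all add: g1_def g2_def g1'_def g2'_def)
  \<comment> \<open>Parameter t counted from (u, v) is parameter t + 1 counted from (x, y).\<close>
  have "poly [:peval c u v, g1', g2' / 2, g3', top4 c h k:] t =
      poly ([:peval c x y, g1, g2 / 2, g3, top4 c h k:] \<circ>\<^sub>p [:1, 1:]) t" for t
  proof -
    have "peval c (u + t * h) (v + t * k) = peval c (x + (t + 1) * h) (y + (t + 1) * k)"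
      by (simp add: h_def k_def algebra_simps)
    then show ?thesis unfolding g3 g3' poly_pcompose
      by (simp add: algebra_simps power2_eq_square power3_eq_cube power4_eq_xxxx)
  qed
  then have "[:peval c u v, g1', g2' / 2, g3', top4 c h k:] =
      [:peval c x y, g1, g2 / 2, g3, top4 c h k:] \<circ>\<^sub>p [:1, 1:]"
    by (simp add: poly_eq_poly_eq_iff[symmetric] fun_eq_iff)
  then have "g1' = g1 + g2 + 3 * g3 + 4 * top4 c h k" "g2' / 2 = g2 / 2 + 3 * g3 + 6 * top4 c h k"
    by (simp_all add: pcompose_pCons)
  moreover have "top4 c h k > 0" using \<open>P \<noteq> Q\<close> by (intro pos) (auto simp: PQ h_def k_def)
  ultimately show False using 0 by linarith
qed

lemma local_max_card:
  assumes "supp4 c" "\<And>x y :: real. (x, y) \<noteq> (0, 0) \<Longrightarrow> top4 c x y > 0"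
  shows "card (local_max_points c) \<le> 1"
    and "local_max_points c \<noteq> {} \<Longrightarrow> card (local_max_points c) = 1"
proof -
  have *: "local_max_points c = {} \<or> (\<exists>P. local_max_points c = {P})"
    using local_max_unique[OF assms] by blast
  then show "card (local_max_points c) \<le> 1" by auto
  show "card (local_max_points c) = 1" if "local_max_points c \<noteq> {}" using * that by auto
qed

section \<open>Growth at infinity and the global minimum\<close>

lemma monomial_lower_bound:
  fixes a x y s :: real
  assumes "\<bar>x\<bar> \<le> s" "\<bar>y\<bar> \<le> s" "1 \<le> s" "i + j \<le> 3"
  shows "a * (x^i * y^j) \<ge> - \<bar>a\<bar> * s^3"
proof -
  have "\<bar>x^i * y^j\<bar> \<le> s^i * s^j"
    unfolding abs_mult power_abs using assms by (intro mult_mono power_mono) auto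
  also have "\<dots> \<le> s^3" using power_increasing[OF assms(4,3)] by (simp add: power_add)
  finally have "\<bar>a * (x^i * y^j)\<bar> \<le> \<bar>a\<bar> * s^3" unfolding abs_mult by (intro mult_left_mono) auto
  then show ?thesis by linarith
qed

lemma top4_scale:
  fixes x y :: "'a::real_field"
  shows "top4 c (s * x) (s * y) = s^4 * top4 c x y"
  by (simp add: top4_expand algebra_simps power2_eq_square power3_eq_cube power4_eq_xxxx)

text \<open>Take m to be the minimum of the form on the compact unit circle and extend by
  homogeneity.\<close>

lemma top4_lower_bound:
  assumes pos: "\<And>x y :: real. (x, y) \<noteq> (0, 0) \<Longrightarrow> top4 c x y > 0"
  obtains m where "m > 0" "\<And>x y :: real. top4 c x y \<ge> m * norm (x, y)^4"
proof -
  let ?f = "\<lambda>p :: real \<times> real. top4 c (fst p) (snd p)"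
  have "continuous_on (sphere 0 1) ?f"
    unfolding top4_expand by (intro continuous_intros)
  then have "\<exists>p\<in>sphere 0 1. \<forall>q\<in>sphere 0 1. ?f p \<le> ?f q"
    by (intro continuous_attains_inf) auto
  then obtain p where p: "p \<in> sphere 0 1" "\<And>q. q \<in> sphere 0 1 \<Longrightarrow> ?f p \<le> ?f q"
    by blast
  have "p \<noteq> (0, 0)" using p(1) by auto
  then have "?f p > 0" by (intro pos) (simp add: prod_eq_iff)
  moreover have "top4 c x y \<ge> ?f p * norm (x, y)^4" for x y
  proof (cases "(x, y) = 0")
    case True
    then show ?thesis by (simp add: top4_expand zero_prod_def)
  next
    case False
    define s where "s = norm (x, y)"
    have "s > 0" using False unfolding s_def zero_less_norm_iff .
    have "(x / s, y / s) \<in> sphere 0 1"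
    proof -
      have "(x / s, y / s) = (1 / s) *\<^sub>R (x, y)" by simp
      also have "norm \<dots> = 1" using \<open>s > 0\<close> by (simp only: norm_scaleR s_def[symmetric]) simp
      finally show ?thesis by simp
    qed
    then have "?f p \<le> top4 c (x / s) (y / s)" using p(2) by force
    then have "s^4 * ?f p \<le> s^4 * top4 c (x / s) (y / s)" using \<open>s > 0\<close> by (intro mult_left_mono) auto
    also have "\<dots> = top4 c x y" using \<open>s > 0\<close> by (simp flip: top4_scale)
    finally show ?thesis by (simp add: s_def mult.commute)
  qed
  ultimately show ?thesis by (rule that)
qed

text \<open>Outside a large ball the values are at least the value at the origin, so a minimum over
  the ball is global.\<close>

lemma global_min_exists:
  assumes s: "supp4 c" and pos: "\<And>x y :: real. (x, y) \<noteq> (0, 0) \<Longrightarrow> top4 c x y > 0"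
  obtains x y :: real where "\<And>u v. peval c x y \<le> peval c u v"
proof -
  obtain m where m: "m > 0" "\<And>x y :: real. top4 c x y \<ge> m * norm (x, y)^4"
    using top4_lower_bound[OF pos] by blast
  define K where "K = \<bar>c 0 1\<bar> + \<bar>c 0 2\<bar> + \<bar>c 0 3\<bar> + \<bar>c 1 0\<bar> + \<bar>c 1 1\<bar> + \<bar>c 1 2\<bar> + \<bar>c 2 0\<bar> + \<bar>c 2 1\<bar> + \<bar>c 3 0\<bar>"
  \<comment> \<open>Radius at least 1 lets s^3 bound all lower monomials; radius at least
    \<open>K / m\<close> lets m s^4 dominate their total K s^3.\<close>
  define R where "R = max 1 (K / m)"
  have far: "peval c 0 0 \<le> peval c x y" if "norm (x, y) \<ge> R" for x y :: real
  proof -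
    define s where "s = norm (x, y)"
    have s1: "1 \<le> s" and sK: "K \<le> m * s"
      using that \<open>m > 0\<close> by (auto simp: R_def s_def field_simps)
    have xs: "\<bar>x\<bar> \<le> s" "\<bar>y\<bar> \<le> s"
      using norm_fst_le[of x y] norm_snd_le[of y x] by (auto simp: s_def)
    note b = monomial_lower_bound[OF xs s1]
    have "peval c x y = c 0 0 + (c 0 1 * (x^0 * y^1) + c 0 2 * (x^0 * y^2) + c 0 3 * (x^0 * y^3)
        + c 1 0 * (x^1 * y^0) + c 1 1 * (x^1 * y^1) + c 1 2 * (x^1 * y^2) + c 2 0 * (x^2 * y^0)
        + c 2 1 * (x^2 * y^1) + c 3 0 * (x^3 * y^0)) + top4 c x y"
      by (simp add: peval_expand[OF s] top4_expand)
    also have "\<dots> \<ge> c 0 0 + (- \<bar>c 0 1\<bar> * s^3 + - \<bar>c 0 2\<bar> * s^3 + - \<bar>c 0 3\<bar> * s^3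
        + - \<bar>c 1 0\<bar> * s^3 + - \<bar>c 1 1\<bar> * s^3 + - \<bar>c 1 2\<bar> * s^3 + - \<bar>c 2 0\<bar> * s^3
        + - \<bar>c 2 1\<bar> * s^3 + - \<bar>c 3 0\<bar> * s^3) + m * s^4"
      using m(2)[of x y] unfolding s_def[symmetric] by (intro add_mono b order_refl) auto
    also have "c 0 0 + (- \<bar>c 0 1\<bar> * s^3 + - \<bar>c 0 2\<bar> * s^3 + - \<bar>c 0 3\<bar> * s^3
        + - \<bar>c 1 0\<bar> * s^3 + - \<bar>c 1 1\<bar> * s^3 + - \<bar>c 1 2\<bar> * s^3 + - \<bar>c 2 0\<bar> * s^3
        + - \<bar>c 2 1\<bar> * s^3 + - \<bar>c 3 0\<bar> * s^3) + m * s^4 = c 0 0 + (m * s - K) * s^3"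
      by (simp add: K_def algebra_simps power3_eq_cube power4_eq_xxxx)
    finally have "c 0 0 + (m * s - K) * s^3 \<le> peval c x y" .
    moreover have "(m * s - K) * s^3 \<ge> 0" using sK s1 by (intro mult_nonneg_nonneg) auto
    ultimately show ?thesis by (simp add: peval_expand[OF s])
  qed
  let ?f = "\<lambda>p :: real \<times> real. peval c (fst p) (snd p)"
  have "continuous_on (cball 0 R) ?f"
    unfolding peval_expand[OF s] by (intro continuous_intros)
  moreover have 0: "(0 :: real \<times> real) \<in> cball 0 R" by (simp add: R_def)
  ultimately obtain p where p: "\<And>q. q \<in> cball 0 R \<Longrightarrow> ?f p \<le> ?f q"
    using continuous_attains_inf[of "cball 0 R" ?f] by (metis compact_cball empty_iff)
  have "?f p \<le> peval c u v" for u v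
  proof (cases "norm (u, v) \<le> R")
    case True
    then show ?thesis using p[of "(u, v)"] by simp
  next
    case False
    then show ?thesis using far[of u v] p[OF 0] by simp
  qed
  then show ?thesis by (rule that)
qed

lemma global_min_crit:
  assumes s: "supp4 c" and min: "\<And>u v. peval c x y \<le> (peval c u v :: real)"
  shows "(x, y) \<in> real_crit_points c"
proof -
  have *: "peval (dx c) x y * h + peval (dy c) x y * k = 0" for h k
  proof -
    obtain g3 where g3: "\<And>t. peval c (x + t * h) (y + t * k) = peval c x y
      + (peval (dx c) x y * h + peval (dy c) x y * k) * t
      + ((peval (dx (dx c)) x y * h^2 + 2 * peval (dx (dy c)) x y * h * k + peval (dy (dy c)) x y * k^2) / 2) * t^2
      + g3 * t^3 + top4 c h k * t^4"
      using peval_line[OF s] by blast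
    \<comment> \<open>A minimum of f along the line is a maximum of -f, to which the first-order
      part of \<open>quartic_local_max\<close> applies.\<close>
    have "- peval c x y + - (peval (dx c) x y * h + peval (dy c) x y * k) * t
      + - ((peval (dx (dx c)) x y * h^2 + 2 * peval (dx (dy c)) x y * h * k + peval (dy (dy c)) x y * k^2) / 2) * t^2
      + - g3 * t^3 + - top4 c h k * t^4 \<le> - peval c x y" for t
      using min[of "x + t * h" "y + t * k"] unfolding g3 by (simp add: algebra_simps)
    from quartic_local_max(1)[OF zero_less_one this] show ?thesis by simp
  qed
  show ?thesis using *[of 1 0] *[of 0 1] by (simp add: real_crit_points_def)
qed

text \<open>Otherwise f would be constant near the point, and a nearby point would be a second local
  maximum.\<close>

lemma local_max_not_global_min:
  assumes s: "supp4 c" and pos: "\<And>x y :: real. (x, y) \<noteq> (0, 0) \<Longrightarrow> top4 c x y > 0"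
    and min: "\<And>u v. peval c x y \<le> (peval c u v :: real)"
  shows "(x, y) \<notin> local_max_points c"
proof
  assume max: "(x, y) \<in> local_max_points c"
  then obtain e where "e > 0" and e: "\<And>u v. (u - x)^2 + (v - y)^2 < e^2 \<Longrightarrow> peval c u v \<le> peval c x y"
    unfolding local_max_points_def by auto
  have "(x + e / 2, y) \<in> local_max_points c"
    unfolding local_max_points_def mem_Collect_eq prod.case
  proof (intro exI[of _ "e / 2"] conjI allI impI)
    fix u v assume uv: "(u - (x + e / 2))^2 + (v - y)^2 < (e / 2)^2"
    have "(u - (x + e / 2))^2 < (e / 2)^2" using uv by (smt (verit) zero_le_power2)
    then have "\<bar>u - (x + e / 2)\<bar> < e / 2"
      using \<open>e > 0\<close> power2_less_imp_less[of "\<bar>u - (x + e / 2)\<bar>" "e / 2"] by simp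
    then have "(u - x)^2 + (v - y)^2 < e^2"
    proof -
      assume "\<bar>u - (x + e / 2)\<bar> < e / 2"
      then have "0 < u - x" "u - x < e" by linarith+
      \<comment> \<open>Since (u - x)^2 = (u - x - e/2)^2 + e (u - x) - e^2/4, assumption
        \<open>uv\<close> bounds the required sum by e (u - x).\<close>
      then have "e * (u - x) < e * e" using \<open>e > 0\<close> by simp
      then show ?thesis using uv by (simp add: power2_eq_square algebra_simps)
    qed
    then have "peval c u v \<le> peval c x y" by (rule e)
    also have "\<dots> \<le> peval c (x + e / 2) y" by (rule min)
    finally show "peval c u v \<le> peval c (x + e / 2) y" .
  qed (use \<open>e > 0\<close> in simp)
  from local_max_unique[OF s pos max this] \<open>e > 0\<close> show False by simp
qed

lemma local_max_crit_count:
  assumes s: "supp4 c" and pos: "\<And>x y :: real. (x, y) \<noteq> (0, 0) \<Longrightarrow> top4 c x y > 0"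
    and "local_max_points c \<noteq> {}"
  shows "card (real_crit_points c) \<noteq> 1"
proof
  assume "card (real_crit_points c) = 1"
  then obtain P where P: "real_crit_points c = {P}" by (auto simp: card_1_singleton_iff)
  obtain x y :: real where min: "\<And>u v. peval c x y \<le> peval c u v"
    using global_min_exists[OF s pos] by blast
  have "(x, y) = P" using global_min_crit[OF s min] P by simp
  moreover have "local_max_points c = {P}" using local_max_crit[OF s] P assms(3) by auto
  ultimately show False using local_max_not_global_min[OF s pos min] by simp
qed

section \<open>Realization\<close>

definition cubic :: "real \<Rightarrow> real \<Rightarrow> real \<Rightarrow> real \<Rightarrow> 'a::real_field \<Rightarrow> 'a" where
  "cubic a3 a2 a1 a0 x = of_real a3 * x^3 + of_real a2 * x^2 + of_real a1 * x + of_real a0"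

definition dcubic :: "real \<Rightarrow> real \<Rightarrow> real \<Rightarrow> 'a::real_field \<Rightarrow> 'a" where
  "dcubic a3 a2 a1 x = 3 * of_real a3 * x^2 + 2 * of_real a2 * x + of_real a1"

text \<open>The polynomial y^4 + Q(x) y^2 + P(x). P is parametrised by the coefficients of P',
  whence the divisors 4, 3 and 2; thus \<open>cubic\<close> is P' and \<open>dcubic\<close> is
  P''.\<close>

definition biquad :: "real \<Rightarrow> real \<Rightarrow> real \<Rightarrow> real \<Rightarrow> real \<Rightarrow> real \<Rightarrow> nat \<Rightarrow> nat \<Rightarrow> real" where
  "biquad q2 q0 a3 a2 a1 a0 i j =
    (if (i, j) = (0, 4) then 1 else if (i, j) = (2, 2) then q2 else if (i, j) = (0, 2) then q0
     else if (i, j) = (4, 0) then a3 / 4 else if (i, j) = (3, 0) then a2 / 3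
     else if (i, j) = (2, 0) then a1 / 2 else if (i, j) = (1, 0) then a0 else 0)"

definition quad :: "real \<Rightarrow> real \<Rightarrow> 'a::real_field \<Rightarrow> 'a" where
  "quad q2 q0 x = of_real q2 * x^2 + of_real q0"

lemma supp4_biquad: "supp4 (biquad q2 q0 a3 a2 a1 a0)"
  by (auto simp: supp4_def biquad_def)

lemma
  fixes x y :: "'a::real_field"
  shows peval_biquad: "peval (biquad q2 q0 a3 a2 a1 a0) x y = y^4 + quad q2 q0 x * y^2
      + of_real (a3/4) * x^4 + of_real (a2/3) * x^3 + of_real (a1/2) * x^2 + of_real a0 * x"
    and peval_dx_biquad: "peval (dx (biquad q2 q0 a3 a2 a1 a0)) x y = 2 * of_real q2 * x * y^2 + cubic a3 a2 a1 a0 x"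
    and peval_dy_biquad: "peval (dy (biquad q2 q0 a3 a2 a1 a0)) x y = 2 * y * (2 * y^2 + quad q2 q0 x)"
    and peval_dx_dx_biquad: "peval (dx (dx (biquad q2 q0 a3 a2 a1 a0))) x y = 2 * of_real q2 * y^2 + dcubic a3 a2 a1 x"
    and peval_dx_dy_biquad: "peval (dx (dy (biquad q2 q0 a3 a2 a1 a0))) x y = 4 * of_real q2 * x * y"
    and peval_dy_dy_biquad: "peval (dy (dy (biquad q2 q0 a3 a2 a1 a0))) x y = 12 * y^2 + 2 * quad q2 q0 x"
    and top4_biquad: "top4 (biquad q2 q0 a3 a2 a1 a0) x y = y^4 + of_real q2 * x^2 * y^2 + of_real (a3/4) * x^4"
  unfolding peval_expand[OF supp4_biquad] peval_dx[OF supp4_biquad] peval_dy[OF supp4_biquad]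
    peval_dx_dx[OF supp4_biquad] peval_dx_dy[OF supp4_biquad] peval_dy_dy[OF supp4_biquad] top4_expand
  by (simp_all add: biquad_def quad_def cubic_def dcubic_def algebra_simps power2_eq_square power3_eq_cube)

text \<open>On the curve $2 y^2 + Q(x) = 0$, where $Q(x) = q_2 x^2 + q_0$, the polynomial $y^4 + Q(x) y^2 + P(x)$
  equals $R(x) = P(x) - Q(x)^2 / 4$; the cubic with coefficients $a_3 - q_2^2$, $a_2$, $a_1 - q_2 q_0$, $a_0$
  below is $R'$.\<close>

lemma crit_biquad_iff:
  fixes x y :: "'a::real_field"
  shows "peval (dx (biquad q2 q0 a3 a2 a1 a0)) x y = 0 \<and> peval (dy (biquad q2 q0 a3 a2 a1 a0)) x y = 0 \<longleftrightarrow>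
    y = 0 \<and> cubic a3 a2 a1 a0 x = 0 \<or>
    2 * y^2 + quad q2 q0 x = 0 \<and> cubic (a3 - q2^2) a2 (a1 - q2 * q0) a0 x = 0"
proof -
  have *: "2 * of_real q2 * x * y^2 + cubic a3 a2 a1 a0 x =
      of_real q2 * x * (2 * y^2 + quad q2 q0 x) + cubic (a3 - q2^2) a2 (a1 - q2 * q0) a0 x"
    by (simp add: cubic_def quad_def algebra_simps power2_eq_square power3_eq_cube)
  show ?thesis
  proof (cases "2 * y^2 + quad q2 q0 x = 0")
    case True
    then show ?thesis using * by (auto simp: peval_dx_biquad peval_dy_biquad)
  next
    case False
    then show ?thesis by (auto simp: peval_dx_biquad peval_dy_biquad)
  qed
qed

text \<open>Critical points lying on both the axis and the curve are assigned to the axis, which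
  makes the two cases disjoint.\<close>

lemma crit_biquad_cases:
  fixes x y :: "'a::real_field"
  assumes "peval (dx (biquad q2 q0 a3 a2 a1 a0)) x y = 0 \<and> peval (dy (biquad q2 q0 a3 a2 a1 a0)) x y = 0"
  shows "y = 0 \<and> cubic a3 a2 a1 a0 x = 0 \<or>
    y \<noteq> 0 \<and> 2 * y^2 + quad q2 q0 x = 0 \<and> cubic (a3 - q2^2) a2 (a1 - q2 * q0) a0 x = 0"
proof (cases "y = 0")
  case True
  then show ?thesis using assms by (simp add: peval_dx_biquad)
next
  case False
  then show ?thesis using assms by (simp add: crit_biquad_iff)
qed

text \<open>The quartic part is quadratic in w^2 and splits into the forms w + s z, w - s z, w + t
  z, w - t z. Here \<open>a3 \<noteq> 0\<close> makes s and t nonzero, and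
  \<open>q2^2 \<noteq> a3\<close> makes s^2 and t^2 distinct.\<close>

lemma nondegenerate4_biquad:
  assumes "a3 \<noteq> 0" "q2^2 \<noteq> a3"
  shows "nondegenerate4 (biquad q2 q0 a3 a2 a1 a0)"
proof -
  define D :: complex where "D = csqrt (of_real (q2^2 - a3))"
  define s t where "s = csqrt ((- of_real q2 + D) / 2)" and "t = csqrt ((- of_real q2 - D) / 2)"
  have D: "D^2 = of_real q2^2 - of_real a3" by (simp add: D_def)
  have "D^2 \<noteq> 0" using assms(2) unfolding D by (simp flip: of_real_power)
  then have "D \<noteq> 0" by auto
  have s2: "s^2 = (- of_real q2 + D) / 2" and t2: "t^2 = (- of_real q2 - D) / 2" by (simp_all add: s_def t_def)
  have st: "s^2 + t^2 = - of_real q2" by (simp add: s2 t2 field_simps)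
  have "4 * (s^2 * t^2) = of_real q2^2 - D^2" unfolding s2 t2 by (simp add: field_simps power2_eq_square)
  then have st': "4 * (s^2 * t^2) = of_real a3" by (simp add: D)
  then have "s^2 * t^2 \<noteq> 0" using assms(1) by auto
  then have "s \<noteq> 0" "t \<noteq> 0" by auto
  have "s^2 - t^2 = D" by (simp add: s2 t2 field_simps)
  then have "(s - t) * (s + t) \<noteq> 0" using \<open>D \<noteq> 0\<close> by (simp add: algebra_simps power2_eq_square)
  then have "s \<noteq> t" "s \<noteq> - t" by auto
  define a :: "nat \<Rightarrow> complex" where "a k = [s, -s, t, -t] ! k" for k
  have "a k \<noteq> a l" if "k < 4" "l < 4" "k \<noteq> l" for k l
  proof -
    have "distinct [s, -s, t, -t]"
      using \<open>s \<noteq> 0\<close> \<open>t \<noteq> 0\<close> \<open>s \<noteq> t\<close> \<open>s \<noteq> - t\<close>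
      by (auto simp: eq_neg_iff_add_eq_0 add.commute)
    then show ?thesis using that unfolding a_def by (subst nth_eq_iff_index_eq) auto
  qed
  then have "a k * 1 - a l * 1 \<noteq> 0" if "k < 4" "l < 4" "k \<noteq> l" for k l using that by simp
  moreover have "top4 (biquad q2 q0 a3 a2 a1 a0) z w = (\<Prod>k<4. a k * z + 1 * w)" for z w
  proof -
    have "{..<4::nat} = {0, 1, 2, 3}" by auto
    then have "(\<Prod>k<4. a k * z + 1 * w) = (s * z + w) * (- s * z + w) * (t * z + w) * (- t * z + w)"
      by (simp add: a_def eval_nat_numeral)
    also have "\<dots> = w^4 - (s^2 + t^2) * z^2 * w^2 + s^2 * t^2 * z^4"
      by (simp add: algebra_simps power2_eq_square power4_eq_xxxx)
    also have "\<dots> = top4 (biquad q2 q0 a3 a2 a1 a0) z w"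
      using st' unfolding st top4_biquad by (simp add: field_simps)
    finally show ?thesis ..
  qed
  ultimately show ?thesis unfolding nondegenerate4_def by (intro exI[of _ a] exI[of _ "\<lambda>_. 1"]) blast
qed

lemma top4_biquad_pos:
  fixes x y :: real
  assumes "a3 > 0" "q2 \<ge> 0 \<or> q2^2 < a3" "(x, y) \<noteq> (0, 0)"
  shows "top4 (biquad q2 q0 a3 a2 a1 a0) x y > 0"
proof (cases "x = 0")
  case True
  then show ?thesis using assms(3) by (simp add: top4_biquad)
next
  case False
  then have x: "x^4 > 0" by simp
  from assms(2) show ?thesis
  proof
    assume "q2 \<ge> 0"
    then have "q2 * x^2 * y^2 \<ge> 0" by simp
    moreover have "a3 / 4 * x^4 > 0" using assms(1) x by simp
    moreover have "y^4 \<ge> 0" by simp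
    ultimately show ?thesis unfolding top4_biquad of_real_eq_id id_apply by linarith
  next
    assume "q2^2 < a3"
    then have "(a3 - q2^2) * x^4 > 0" using x by simp
    \<comment> \<open>Completing the square handles negative \<open>q2\<close>.\<close>
    moreover have "4 * (y^4 + q2 * x^2 * y^2 + a3 / 4 * x^4) = (2 * y^2 + q2 * x^2)^2 + (a3 - q2^2) * x^4"
      by (simp add: algebra_simps power2_eq_square power4_eq_xxxx)
    ultimately have "4 * (y^4 + q2 * x^2 * y^2 + a3 / 4 * x^4) > 0" by (simp add: add_nonneg_pos)
    then show ?thesis unfolding top4_biquad by simp
  qed
qed

text \<open>The Hessian determinant is 2 Q P'' on the axis and 8 w^2 R'' at points of the curve, so
  simplicity of the roots of P' and R' together with Q nonzero at the roots of P' suffices.\<close>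

lemma morse4_biquad:
  assumes "a3 \<noteq> 0" "q2^2 \<noteq> a3"
    and P: "\<And>z :: complex. cubic a3 a2 a1 a0 z = 0 \<Longrightarrow> dcubic a3 a2 a1 z \<noteq> 0 \<and> quad q2 q0 z \<noteq> 0"
    and R: "\<And>z :: complex. cubic (a3 - q2^2) a2 (a1 - q2 * q0) a0 z = 0 \<Longrightarrow>
      dcubic (a3 - q2^2) a2 (a1 - q2 * q0) z \<noteq> 0"
  shows "morse4 (biquad q2 q0 a3 a2 a1 a0)"
  unfolding morse4_def
proof (intro conjI allI impI)
  fix z w :: complex assume "complex_crit (biquad q2 q0 a3 a2 a1 a0) z w"
  then have "peval (dx (biquad q2 q0 a3 a2 a1 a0)) z w = 0 \<and> peval (dy (biquad q2 q0 a3 a2 a1 a0)) z w = 0"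
    by (simp add: complex_crit_def)
  then consider (axis) "w = 0" "cubic a3 a2 a1 a0 z = 0"
    | (curve) "w \<noteq> 0" "2 * w^2 + quad q2 q0 z = 0" "cubic (a3 - q2^2) a2 (a1 - q2 * q0) a0 z = 0"
    using crit_biquad_cases by metis
  then show "hess_det (biquad q2 q0 a3 a2 a1 a0) z w \<noteq> 0"
  proof cases
    case axis
    then show ?thesis using P[OF axis(2)]
      by (simp add: hess_det_def peval_dx_dx_biquad peval_dx_dy_biquad peval_dy_dy_biquad)
  next
    case curve
    have "hess_det (biquad q2 q0 a3 a2 a1 a0) z w
        = 8 * w^2 * dcubic (a3 - q2^2) a2 (a1 - q2 * q0) z
          + (2 * w^2 + quad q2 q0 z) * (12 * of_real q2 * w^2 + 2 * dcubic a3 a2 a1 z)"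
      unfolding hess_det_def peval_dx_dx_biquad peval_dx_dy_biquad peval_dy_dy_biquad
      by (simp add: dcubic_def quad_def algebra_simps power2_eq_square)
    then show ?thesis using curve R[OF curve(3)] by simp
  qed
qed (use assms supp4_biquad nondegenerate4_biquad in auto)

lemma card_real_crit_biquad:
  fixes q2 q0 a3 a2 a1 a0 :: real
  defines "A \<equiv> {x :: real. cubic a3 a2 a1 a0 x = 0}"
    and "B \<equiv> {x :: real. cubic (a3 - q2^2) a2 (a1 - q2 * q0) a0 x = 0 \<and> quad q2 q0 x < 0}"
  assumes "finite A" "finite B"
  shows "card (real_crit_points (biquad q2 q0 a3 a2 a1 a0)) = card A + 2 * card B"
proof -
  define r where "r x = sqrt (- quad q2 q0 x / 2)" for x
  have r: "2 * (r x)^2 + quad q2 q0 x = 0" "r x > 0" if "x \<in> B" for x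
    using that by (auto simp: r_def B_def)
  have sq: "y = r x \<or> y = - r x" if "2 * y^2 + quad q2 q0 x = 0" for x y
  proof -
    have "- quad q2 q0 x / 2 = y^2" using that by simp
    then have "r x = \<bar>y\<bar>" by (simp add: r_def)
    then show ?thesis by auto
  qed
  have eq: "real_crit_points (biquad q2 q0 a3 a2 a1 a0) =
    (\<lambda>x. (x, 0)) ` A \<union> ((\<lambda>x. (x, r x)) ` B \<union> (\<lambda>x. (x, - r x)) ` B)" (is "?L = ?R")
  proof (intro set_eqI iffI)
    fix p assume "p \<in> ?L"
    then obtain x y where p: "p = (x, y)" and crit: "peval (dx (biquad q2 q0 a3 a2 a1 a0)) x y = 0 \<and>
        peval (dy (biquad q2 q0 a3 a2 a1 a0)) x y = 0"
      by (cases p) (auto simp: real_crit_points_def)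
    from crit_biquad_cases[OF crit] show "p \<in> ?R"
    proof (elim disjE conjE)
      assume "y \<noteq> 0" and y: "2 * y^2 + quad q2 q0 x = 0" and "cubic (a3 - q2^2) a2 (a1 - q2 * q0) a0 x = 0"
      moreover have "quad q2 q0 x = - (2 * y^2)" using y by (simp add: add_eq_0_iff2)
      ultimately have "x \<in> B" by (simp add: B_def)
      then show ?thesis using sq[OF y] unfolding p by auto
    qed (auto simp: p A_def)
  next
    fix p assume "p \<in> ?R"
    then obtain x y where p: "p = (x, y)" and
      "y = 0 \<and> x \<in> A \<or> y = r x \<and> x \<in> B \<or> y = - r x \<and> x \<in> B"
      by (cases p) auto
    then have "y = 0 \<and> cubic a3 a2 a1 a0 x = 0 \<or>
       2 * y^2 + quad q2 q0 x = 0 \<and> cubic (a3 - q2^2) a2 (a1 - q2 * q0) a0 x = 0"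
      using r[of x] by (auto simp: A_def B_def)
    then show "p \<in> ?L" unfolding p real_crit_points_def by (simp add: crit_biquad_iff)
  qed
  \<comment> \<open>The three images are disjoint because Q < 0 on B makes \<open>r\<close> positive
    there.\<close>
  have "card ?R = card ((\<lambda>x. (x, 0::real)) ` A) + card ((\<lambda>x. (x, r x)) ` B \<union> (\<lambda>x. (x, - r x)) ` B)"
    by (intro card_Un_disjoint) (auto simp: \<open>finite A\<close> \<open>finite B\<close> dest!: r(2))
  also have "card ((\<lambda>x. (x, r x)) ` B \<union> (\<lambda>x. (x, - r x)) ` B) = card ((\<lambda>x. (x, r x)) ` B) + card ((\<lambda>x. (x, - r x)) ` B)"
    using r(2) by (intro card_Un_disjoint) (fastforce simp: \<open>finite A\<close> \<open>finite B\<close>)+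
  finally show ?thesis unfolding eq by (simp add: card_image inj_on_def)
qed

lemma local_max_biquad:
  fixes x :: real
  assumes P': "cubic a3 a2 a1 a0 x = 0" and P'': "dcubic a3 a2 a1 x < 0" and Q: "quad q2 q0 x < 0"
  shows "(x, 0) \<in> local_max_points (biquad q2 q0 a3 a2 a1 a0)"
proof -
  let ?f = "peval (biquad q2 q0 a3 a2 a1 a0) :: real \<Rightarrow> real \<Rightarrow> real"
  \<comment> \<open>The second-order Taylor quotient of P at x: P(u) = P(x) + (u - x) P'(x) + (u -
    x)^2 T(u), with T(x) = P''(x)/2.\<close>
  let ?T = "\<lambda>u. dcubic a3 a2 a1 x / 2 + (a3 * x + a2 / 3) * (u - x) + a3 / 4 * (u - x)^2"
  have f: "?f u v - ?f x 0 = v^2 * (v^2 + quad q2 q0 u) + (u - x)^2 * ?T u" for u v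
  proof -
    have "?f u v - ?f x 0 = v^2 * (v^2 + quad q2 q0 u) + (u - x)^2 * ?T u + (u - x) * cubic a3 a2 a1 a0 x"
      by (simp add: peval_biquad cubic_def dcubic_def field_simps power2_eq_square power3_eq_cube power4_eq_xxxx)
    then show ?thesis using P' by simp
  qed
  have "(?T \<longlongrightarrow> dcubic a3 a2 a1 x / 2 + (a3 * x + a2 / 3) * (x - x) + a3 / 4 * (x - x)^2) (nhds x)"
    "(quad q2 q0 \<longlongrightarrow> quad q2 q0 x) (nhds x)"
    unfolding quad_def by (intro tendsto_intros filterlim_ident)+
  from order_tendstoD(2)[OF this(1), of 0] order_tendstoD(2)[OF this(2), of "quad q2 q0 x / 2"]
  have "eventually (\<lambda>u. ?T u < 0) (nhds x)" "eventually (\<lambda>u. quad q2 q0 u < quad q2 q0 x / 2) (nhds x)"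
    using P'' Q by simp_all
  then have "eventually (\<lambda>u. ?T u < 0 \<and> quad q2 q0 u < quad q2 q0 x / 2) (nhds x)" by (rule eventually_conj)
  then obtain d where d: "d > 0" "\<And>u. \<bar>u - x\<bar> < d \<Longrightarrow> ?T u < 0 \<and> quad q2 q0 u < quad q2 q0 x / 2"
    by (auto simp: eventually_nhds_metric dist_real_def)
  \<comment> \<open>Within this radius v^2 < -Q(x)/2 while Q(u) < Q(x)/2, so both summands in
    \<open>f\<close> are at most 0.\<close>
  define e where "e = min d (sqrt (- quad q2 q0 x / 2))"
  have e: "e > 0" "e \<le> d" using d(1) Q by (auto simp: e_def)
  have "e^2 \<le> (sqrt (- quad q2 q0 x / 2))^2" using e(1) by (intro power_mono) (auto simp: e_def)
  then have e2: "e^2 \<le> - quad q2 q0 x / 2" using Q by simp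
  have "?f u v \<le> ?f x 0" if "(u - x)^2 + (v - 0)^2 < e^2" for u v
  proof -
    have "(u - x)^2 < e^2" "v^2 < e^2" using that by (smt (verit) zero_le_power2 diff_zero)+
    then have "\<bar>u - x\<bar> < d" using e power2_less_imp_less[of "\<bar>u - x\<bar>" e] by simp
    then have "?T u < 0" "v^2 + quad q2 q0 u \<le> 0" using d(2)[of u] e2 \<open>v^2 < e^2\<close> by auto
    then have "v^2 * (v^2 + quad q2 q0 u) \<le> 0" "(u - x)^2 * ?T u \<le> 0"
      by (auto intro!: mult_nonneg_nonpos)
    then show ?thesis using f[of u v] by linarith
  qed
  then show ?thesis unfolding local_max_points_def using e(1) by auto
qed

text \<open>A pure second derivative is positive at every critical point: f_yy = 8 y^2 on the curve
  off the axis, and f_xx = P'' or f_yy = 2 Q on the axis.\<close>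

lemma not_local_max_biquad:
  assumes A: "\<And>x :: real. cubic a3 a2 a1 a0 x = 0 \<Longrightarrow> dcubic a3 a2 a1 x > 0 \<or> quad q2 q0 x > 0"
  shows "local_max_points (biquad q2 q0 a3 a2 a1 a0) = {}"
proof (rule equals0I, clarify)
  fix x y assume max: "(x, y) \<in> local_max_points (biquad q2 q0 a3 a2 a1 a0)"
  then have "(x, y) \<in> real_crit_points (biquad q2 q0 a3 a2 a1 a0)"
    using local_max_crit[OF supp4_biquad] by blast
  then have "y = 0 \<and> cubic a3 a2 a1 a0 x = 0 \<or> y \<noteq> 0 \<and> 2 * y^2 + quad q2 q0 x = 0"
    by (auto simp: real_crit_points_def peval_dx_biquad peval_dy_biquad)
  moreover have "2 * q2 * y^2 + dcubic a3 a2 a1 x \<le> 0" "12 * y^2 + 2 * quad q2 q0 x \<le> 0"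
    using local_max_line(2)[OF supp4_biquad max, of 1 0] local_max_line(2)[OF supp4_biquad max, of 0 1]
    by (simp_all add: peval_dx_dx_biquad peval_dy_dy_biquad)
  moreover have "y^2 > 0" if "y \<noteq> 0" using that by simp
  ultimately show False using A[of x] by fastforce
qed

definition realizable :: "nat \<Rightarrow> nat \<Rightarrow> bool" where
  "realizable M m \<longleftrightarrow> (\<exists>c. (M, m) = (card (real_crit_points c), card (local_max_points c)) \<and>
    morse4 c \<and> (\<forall>x y :: real. (x, y) \<noteq> (0, 0) \<longrightarrow> top4 c x y > 0))"

text \<open>Here $P' = p (x - a) (x - b) (x - c)$, $Q = \<mu> x^2 + \<nu>$ and
  $R' = r (x - d) (x^2 + \<beta> x + \<gamma>)$; the assumptions coeffs say that $P' - R' = Q Q' / 2$.\<close>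

lemma realizable_of_factored:
  fixes p r a b c d \<beta> \<gamma> \<mu> \<nu> :: real
  assumes abc: "a < b" "b < c" and p: "p > 0" "r \<noteq> 0" "\<mu> \<ge> 0 \<or> r > 0"
    and coeffs: "p - \<mu>^2 = r" "p * (a + b + c) = r * (d - \<beta>)"
      "p * (a * b + b * c + a * c) - \<mu> * \<nu> = r * (\<gamma> - \<beta> * d)" "p * (a * b * c) = r * (d * \<gamma>)"
    and simple: "d^2 + \<beta> * d + \<gamma> \<noteq> 0" "\<beta>^2 \<noteq> 4 * \<gamma>"
    and Q: "\<mu> * a^2 + \<nu> \<noteq> 0" "\<mu> * b^2 + \<nu> \<noteq> 0" "\<mu> * c^2 + \<nu> \<noteq> 0"
    and B: "{x. (x = d \<or> x^2 + \<beta> * x + \<gamma> = 0) \<and> \<mu> * x^2 + \<nu> < 0} = B" "finite B"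
    and M: "M = 3 + 2 * card B" and m: "m = (if \<mu> * b^2 + \<nu> < 0 then 1 else 0)"
  shows "realizable M m"
proof -
  define a2 a1 a0 where "a2 = - p * (a + b + c)" and "a1 = p * (a * b + b * c + a * c)" and "a0 = - p * (a * b * c)"
  define f where "f = biquad \<mu> \<nu> p a2 a1 a0"
  have P: "cubic p a2 a1 a0 z = of_real p * ((z - of_real a) * (z - of_real b) * (z - of_real c))" for z :: "'a::real_field"
    by (simp add: cubic_def a2_def a1_def a0_def algebra_simps power2_eq_square power3_eq_cube)
  have P': "dcubic p a2 a1 z = of_real p * ((z - of_real a) * (z - of_real b) + (z - of_real b) * (z - of_real c)
      + (z - of_real a) * (z - of_real c))" for z :: "'a::real_field"
    by (simp add: dcubic_def a2_def a1_def algebra_simps power2_eq_square)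
  have coeffs': "p - \<mu>^2 = r" "a2 = r * (\<beta> - d)" "a1 - \<mu> * \<nu> = r * (\<gamma> - \<beta> * d)" "a0 = - (r * (d * \<gamma>))"
    using coeffs by (simp_all add: a2_def a1_def a0_def algebra_simps)
  have R: "cubic (p - \<mu>^2) a2 (a1 - \<mu> * \<nu>) a0 z =
      of_real r * ((z - of_real d) * (z^2 + of_real \<beta> * z + of_real \<gamma>))" for z :: "'a::real_field"
    unfolding coeffs' by (simp add: cubic_def algebra_simps power2_eq_square power3_eq_cube)
  have R': "dcubic (p - \<mu>^2) a2 (a1 - \<mu> * \<nu>) z =
      of_real r * ((z^2 + of_real \<beta> * z + of_real \<gamma>) + (z - of_real d) * (2 * z + of_real \<beta>))" for z :: "'a::real_field"
    unfolding coeffs' by (simp add: dcubic_def algebra_simps power2_eq_square)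
  have quad_real: "quad \<mu> \<nu> (of_real x) = (of_real (\<mu> * x^2 + \<nu>) :: 'a::real_field)" for x
    by (simp add: quad_def)
  have "morse4 f" unfolding f_def
  proof (rule morse4_biquad)
    show "p \<noteq> 0" "\<mu>^2 \<noteq> p" using p coeffs(1) by auto
  next
    fix z :: complex assume "cubic p a2 a1 a0 z = 0"
    then have "z = of_real a \<or> z = of_real b \<or> z = of_real c" using p(1) by (auto simp: P)
    moreover have "quad \<mu> \<nu> (complex_of_real a) \<noteq> 0" "quad \<mu> \<nu> (complex_of_real b) \<noteq> 0"
      "quad \<mu> \<nu> (complex_of_real c) \<noteq> 0"
      unfolding quad_real using Q by (simp_all only: of_real_eq_0_iff not_False_eq_True)
    ultimately show "dcubic p a2 a1 z \<noteq> 0 \<and> quad \<mu> \<nu> z \<noteq> 0"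
      using abc p(1) by (auto simp: P')
  next
    fix z :: complex assume z: "cubic (p - \<mu>^2) a2 (a1 - \<mu> * \<nu>) a0 z = 0"
    define S where "S = z^2 + of_real \<beta> * z + of_real \<gamma>"
    have "of_real (d^2 + \<beta> * d + \<gamma>) \<noteq> (0::complex)" using simple(1) by (simp only: of_real_eq_0_iff not_False_eq_True)
    then have d: "S \<noteq> 0" if "z = of_real d" using that by (simp add: S_def)
    have "of_real (\<beta>^2 - 4 * \<gamma>) \<noteq> (0::complex)" using simple(2) by (simp only: of_real_eq_0_iff right_minus_eq not_False_eq_True)
    \<comment> \<open>Discriminant identity: a nonzero discriminant excludes a double root of the
      quadratic factor of R'.\<close>
    moreover have "(2 * z + of_real \<beta>)^2 = 4 * S + of_real (\<beta>^2 - 4 * \<gamma>)"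
      by (simp add: S_def algebra_simps power2_eq_square)
    ultimately have "2 * z + of_real \<beta> \<noteq> 0" if "S = 0" using that by auto
    moreover have "z = of_real d \<or> S = 0" using z p(2) by (auto simp: R S_def)
    ultimately have "S + (z - of_real d) * (2 * z + of_real \<beta>) \<noteq> 0" using d by auto
    then show "dcubic (p - \<mu>^2) a2 (a1 - \<mu> * \<nu>) z \<noteq> 0" using p(2) by (simp add: R' S_def)
  qed
  have pos: "\<forall>x y :: real. (x, y) \<noteq> (0, 0) \<longrightarrow> top4 f x y > 0"
    unfolding f_def using p coeffs(1) by (auto intro!: top4_biquad_pos)
  have A: "{x :: real. cubic p a2 a1 a0 x = 0} = {a, b, c}" using p(1) by (auto simp: P)
  have B': "{x :: real. cubic (p - \<mu>^2) a2 (a1 - \<mu> * \<nu>) a0 x = 0 \<and> quad \<mu> \<nu> x < 0} = B"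
    using p(2) by (auto simp: R quad_def simp flip: B(1))
  have "card (real_crit_points f) = M"
    using abc card_real_crit_biquad[of p a2 a1 a0 \<mu> \<nu>] B(2) unfolding f_def A B' M by simp
  moreover have "card (local_max_points f) = m"
  proof (cases "\<mu> * b^2 + \<nu> < 0")
    case True
    have "dcubic p a2 a1 b < 0" using abc p(1) by (simp add: P' mult_pos_neg mult_neg_pos)
    then have "(b, 0) \<in> local_max_points f"
      unfolding f_def using True by (intro local_max_biquad) (auto simp: P quad_def)
    then have "card (local_max_points f) = 1"
      using local_max_card(2)[OF supp4_biquad, of \<mu> \<nu> p a2 a1 a0] pos unfolding f_def by blast
    then show ?thesis using True m by simp
  next
    case False
    \<comment> \<open>The outer roots a and c are minima of P, so only b could give a local maximum,
      and there Q is positive.\<close>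
    have *: "dcubic p a2 a1 a > 0" "dcubic p a2 a1 c > 0" "quad \<mu> \<nu> b > 0"
      using abc p(1) False Q(2) by (simp_all add: P' mult_neg_neg quad_def)
    have "local_max_points f = {}" unfolding f_def
    proof (rule not_local_max_biquad)
      fix x :: real assume "cubic p a2 a1 a0 x = 0"
      then have "x \<in> {a, b, c}" using A by blast
      then show "dcubic p a2 a1 x > 0 \<or> quad \<mu> \<nu> x > 0"
        using * by blast
    qed
    then show ?thesis using False m by simp
  qed
  ultimately show ?thesis unfolding realizable_def using \<open>morse4 f\<close> pos by blast
qed

section \<open>Explicit polynomials for the nine pairs\<close>

lemma realizable_1_0: "realizable 1 0"
proof -
  \<comment> \<open>This is x^4 + x^2 + y^4 + y^2. It is treated directly because the factored
    criterion always yields three critical points on the axis.\<close>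
  define f where "f = biquad 0 1 4 0 2 0"
  have C: "cubic 4 0 2 0 z = 2 * z * (2 * z^2 + 1)" for z :: "'a::real_field"
    by (simp add: cubic_def algebra_simps power2_eq_square power3_eq_cube)
  \<comment> \<open>At the nonzero complex roots of P', where 2 z^2 + 1 = 0, this gives P'' =
    -4.\<close>
  have C': "2 * z^2 + 1 = u \<Longrightarrow> dcubic 4 0 2 z = 6 * u - 4" for z u :: "'a::real_field"
    by (auto simp: dcubic_def algebra_simps)
  have "morse4 f" unfolding f_def
  proof (rule morse4_biquad)
    have *: "dcubic 4 0 2 z \<noteq> 0" if "cubic 4 0 2 0 z = 0" for z :: complex
    proof (cases "z = 0")
      case True
      then show ?thesis by (simp add: dcubic_def)
    next
      case False
      then have "2 * z^2 + 1 = 0" using that unfolding C by simp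
      from C'[OF this] show ?thesis by simp
    qed
    then show "dcubic 4 0 2 z \<noteq> 0 \<and> quad 0 1 z \<noteq> 0" if "cubic 4 0 2 0 z = 0" for z :: complex
      using that by (simp add: quad_def)
    show "dcubic (4 - 0^2) 0 (2 - 0 * 1) z \<noteq> 0" if "cubic (4 - 0^2) 0 (2 - 0 * 1) 0 z = 0" for z :: complex
      using * that by simp
  qed auto
  moreover have "\<forall>x y :: real. (x, y) \<noteq> (0, 0) \<longrightarrow> top4 f x y > 0"
    unfolding f_def by (auto intro!: top4_biquad_pos)
  moreover have pos: "2 * x^2 + 1 \<noteq> 0" for x :: real
    by (smt (verit) zero_le_power2)
  then have "{x :: real. cubic 4 0 2 0 x = 0} = {0}" by (auto simp: C)
  then have "card (real_crit_points f) = 1"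
    using card_real_crit_biquad[of 4 0 2 0 0 1] by (simp add: f_def quad_def)
  moreover have "local_max_points f = {}"
    unfolding f_def by (rule not_local_max_biquad) (simp add: quad_def)
  ultimately show ?thesis unfolding realizable_def by (metis card.empty)
qed

text \<open>Scheme for all the factored witnesses: the roots of P' and R' are chosen so that the x^2
  and constant coefficients agree for the ratio of p to r; normalising p - r = 1 allows
  \<open>\<mu>\<close> to be 1 or -1, and the linear coefficient then fixes \<open>\<nu>\<close>.
  Here Q = x^2 + 1/2 is positive, so only the axis contributes.\<close>

lemma realizable_3_0: "realizable 3 0"
proof (rule realizable_of_factored[where a = "-1" and b = 0 and c = 1 and p = "1/2" and r = "-1/2"
    and \<mu> = 1 and d = 0 and \<beta> = 0 and \<gamma> = 2 and \<nu> = "1/2" and B = "{}"])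
  have "1 * x^2 + 1 / 2 > 0" for x :: real by (simp add: add_nonneg_pos)
  then show "{x :: real. (x = 0 \<or> x^2 + 0 * x + 2 = 0) \<and> 1 * x^2 + 1 / 2 < 0} = {}"
    by (auto simp: not_less less_imp_le)
qed simp_all

text \<open>Q = x^2 - 19/3 is negative at the maximum 1 of P but positive at 3, the only real root
  of R'.\<close>

lemma realizable_3_1: "realizable 3 1"
proof (rule realizable_of_factored[where a = "-3" and b = 1 and c = 2 and p = "2/3" and r = "-1/3"
    and \<mu> = 1 and d = 3 and \<beta> = 3 and \<gamma> = 4 and \<nu> = "-19/3" and B = "{}"])
  have "x^2 + 3 * x + 4 \<noteq> 0" for x :: real
    using zero_le_power2[of "x + 3 / 2"] by (auto simp: power2_eq_square algebra_simps)
  then show "{x :: real. (x = 3 \<or> x^2 + 3 * x + 4 = 0) \<and> 1 * x^2 + - 19 / 3 < 0} = {}" by auto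
qed simp_all

text \<open>Q = x^2 - 1/4 is positive at the maximum -2 of P; among the roots -1, 0, 3 of R' it is
  negative only at 0.\<close>

lemma realizable_5_0: "realizable 5 0"
proof (rule realizable_of_factored[where a = "-4" and b = "-2" and c = 0 and p = "1/4" and r = "-3/4"
    and \<mu> = 1 and d = "-1" and \<beta> = "-3" and \<gamma> = 0 and \<nu> = "-1/4" and B = "{0}"])
  have "x^2 + - 3 * x + 0 = x * (x - 3)" for x :: real by (simp add: algebra_simps power2_eq_square)
  then show "{x :: real. (x = - 1 \<or> x^2 + - 3 * x + 0 = 0) \<and> 1 * x^2 + - 1 / 4 < 0} = {0}" by auto
qed simp_all

text \<open>The only real root 0 of R' is also the maximum of P, and Q = x^2 - 1/2 is negative
  there.\<close>

lemma realizable_5_1: "realizable 5 1"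
proof (rule realizable_of_factored[where a = "-2" and b = 0 and c = 1 and p = "1/2" and r = "-1/2"
    and \<mu> = 1 and d = 0 and \<beta> = "-1" and \<gamma> = 1 and \<nu> = "-1/2" and B = "{0}"])
  have "x^2 + - 1 * x + 1 \<noteq> 0" for x :: real
    using zero_le_power2[of "x - 1 / 2"] by (auto simp: power2_eq_square algebra_simps)
  then show "{x :: real. (x = 0 \<or> x^2 + - 1 * x + 1 = 0) \<and> 1 * x^2 + - 1 / 2 < 0} = {0}" by auto
qed simp_all

text \<open>With \<open>\<mu> = -1\<close>, Q = 2 - x^2 is positive at the central root 0 shared by
  P' and R' and negative at the outer roots -4 and 4 of R'.\<close>

lemma realizable_7_0: "realizable 7 0"
proof (rule realizable_of_factored[where a = "-3" and b = 0 and c = 3 and p = 2 and r = 1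
    and \<mu> = "-1" and d = 0 and \<beta> = 0 and \<gamma> = "-16" and \<nu> = 2 and B = "{-4, 4}"])
  have "x^2 + 0 * x + - 16 = (x + 4) * (x - 4)" for x :: real by (simp add: algebra_simps power2_eq_square)
  then show "{x :: real. (x = 0 \<or> x^2 + 0 * x + - 16 = 0) \<and> - 1 * x^2 + 2 < 0} = {-4, 4}" by auto
qed simp_all

text \<open>Q = x^2 - 2 is negative at the maximum 0 of P and at the roots -1 and 0 of R', but not
  at its third root 2.\<close>

lemma realizable_7_1: "realizable 7 1"
proof (rule realizable_of_factored[where a = "-2" and b = 0 and c = 1 and p = "1/2" and r = "-1/2"
    and \<mu> = 1 and d = 0 and \<beta> = "-1" and \<gamma> = "-2" and \<nu> = "-2" and B = "{-1, 0}"])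
  have "x^2 + - 1 * x + - 2 = (x + 1) * (x - 2)" for x :: real by (simp add: algebra_simps power2_eq_square)
  then show "{x :: real. (x = 0 \<or> x^2 + - 1 * x + - 2 = 0) \<and> 1 * x^2 + - 2 < 0} = {-1, 0}" by auto
qed simp_all

text \<open>Q = 11 - x^2 is negative at all roots -5, 4, 6 of R' yet positive at the maximum 2 of
  P.\<close>

lemma realizable_9_0: "realizable 9 0"
proof (rule realizable_of_factored[where a = "-4" and b = 2 and c = 3 and p = "5/4" and r = "1/4"
    and \<mu> = "-1" and d = "-5" and \<beta> = "-10" and \<gamma> = 24 and \<nu> = 11 and B = "{-5, 4, 6}"])
  have "x^2 + - 10 * x + 24 = (x - 4) * (x - 6)" for x :: real by (simp add: algebra_simps power2_eq_square)
  then show "{x :: real. (x = - 5 \<or> x^2 + - 10 * x + 24 = 0) \<and> - 1 * x^2 + 11 < 0} = {-5, 4, 6}" by auto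
qed simp_all

text \<open>Q = -x^2 - 2 is negative everywhere, so every root of R' counts and the maximum of P
  stays a local maximum.\<close>

lemma realizable_9_1: "realizable 9 1"
proof (rule realizable_of_factored[where a = "-1" and b = 0 and c = 1 and p = 2 and r = 1
    and \<mu> = "-1" and d = 0 and \<beta> = 0 and \<gamma> = "-4" and \<nu> = "-2" and B = "{-2, 0, 2}"])
  have "x^2 + 0 * x + - 4 = (x + 2) * (x - 2)" for x :: real by (simp add: algebra_simps power2_eq_square)
  then show "{x :: real. (x = 0 \<or> x^2 + 0 * x + - 4 = 0) \<and> - 1 * x^2 + - 2 < 0} = {-2, 0, 2}" by auto
qed simp_all

theorem theorem2:
  shows "{(card (real_crit_points c), card (local_max_points c)) | c.
            morse4 c \<and> (\<forall>x y :: real. (x, y) \<noteq> (0, 0) \<longrightarrow> top4 c x y > 0)}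
         = {(1,0),(3,0),(5,0),(7,0),(9,0),(3,1),(5,1),(7,1),(9,1)}" (is "?L = ?R")
proof (intro subset_antisym subsetI)
  fix P assume "P \<in> ?L"
  then obtain c where P: "P = (card (real_crit_points c), card (local_max_points c))" and c: "morse4 c"
    and pos: "\<And>x y :: real. (x, y) \<noteq> (0, 0) \<Longrightarrow> top4 c x y > 0" by blast
  have s: "supp4 c" using c by (simp add: morse4_def)
  define M m where "M = card (real_crit_points c)" and "m = card (local_max_points c)"
  have M: "odd M" "M \<le> 9" unfolding M_def using crit_count[OF c pos] by auto
  \<comment> \<open>A single critical point leaves no room for a local maximum, which excludes (1,
    1).\<close>
  have "m = 0 \<or> m = 1 \<and> M \<noteq> 1"
    using local_max_card(1)[OF s pos] local_max_crit_count[OF s pos] unfolding M_def m_def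
    by (cases "local_max_points c = {}") auto
  moreover have "M \<in> {1, 3, 5, 7, 9}" using M by (auto elim!: oddE)
  ultimately show "P \<in> ?R" unfolding P M_def[symmetric] m_def[symmetric] by auto
next
  fix P assume "P \<in> ?R"
  then have "realizable (fst P) (snd P)"
    by (elim insertE emptyE) (simp_all only: fst_conv snd_conv realizable_1_0 realizable_3_0 realizable_5_0
      realizable_7_0 realizable_9_0 realizable_3_1 realizable_5_1 realizable_7_1 realizable_9_1)
  then show "P \<in> ?L" unfolding realizable_def by simp
qed

end
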